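(* Let $X\subseteq\mathbb{R}^n$ be a polyhedral set, let $\varphi:\mathbb{R}\to\mathbb{R}$ be a univariate function that is convex or concave, and let $\psi$ satisfy one of the following four assumptions: (a) $\psi$ is a piecewise linear-quadratic function; (b) $\psi(x)=\psi_1(x)+\max_{1\le i\le k_2}\psi_{2i}(x)$ with $\psi_1$ a piecewise affine function and each $\psi_{2i}$ a convex quadratic function; (c) $\psi(x)=\max(\psi_{11}(x),\psi_{12}(x))-\max(\psi_{21}(x),\psi_{22}(x))$ with each $\psi_{ij}$ a quadratic function; (d) $\psi(x)=\max_{1\le i\le k_1}\psi_{1i}(x)-\max_{1\le i\le k_2}\psi_{2i}(x)$, where each $\psi_{1i}$ ($i=1,\ldots,k_1$) is a concave quadratic function, each $\psi_{2i}$ ($i=1,\ldots,k_2$) is a strictly convex quadratic function, and the gradients $\{\nabla\psi_{1i}(\bar x)\}_{i\in\mathcal{A}_1(\bar x)}$ are linearly independent for all $\bar x\in\mathcal{D}_{(\psi,X)}$, where $\mathcal{A}_1(\bar x)=\operatorname{argmax}_{1\le i\le k_1}\psi_{1i}(\bar x)$. Then the composite program $$\min_{x\in X}\; f(x)=\varphi\circ\psi(x)$$ has only finitely many d-stationary values; that is, the set $f(\mathcal{D}_{(f,X)})$ is finite.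
   Context: A polyhedral set is a set of the form $\{x\in\mathbb{R}^n : Ax\le b\}$. A quadratic function is a polynomial of degree at most two on $\mathbb{R}^n$ (its Hessian may be indefinite or zero unless convexity/concavity is stated). Directional derivative: $g'(\bar x;v)=\lim_{\delta\downarrow 0}\frac{g(\bar x+\delta v)-g(\bar x)}{\delta}$. For a function $g$, a point $\bar x\in X$ is a d-stationary point of $\min_{x\in X}g(x)$ if $g'(\bar x;x-\bar x)\ge 0$ for all $x\in X$. $\mathcal{D}_{(g,X)}$ denotes the set of all d-stationary points of $g$ on $X$, and the numbers $g(\bar x)$, $\bar x\in\mathcal{D}_{(g,X)}$, are the d-stationary values. A continuous function $\psi:\mathbb{R}^n\to\mathbb{R}$ is piecewise affine if there exist finitely many affine functions $\psi_1,\ldots,\psi_k$ such that $\psi(x)\in\{\psi_1(x),\ldots,\psi_k(x)\}$ for all $x$. A continuous real-valued function is piecewise linear-quadratic if its domain (here containing $X$) is the union of finitely many polyhedral sets on each of which the function coincides with a quadratic function. *)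

theory Defs
  imports "HOL-Analysis.Analysis"
begin

(* The quantity g'(x; v) is kept as a relation: "has_dir_deriv g x v d" says that the one-sided
   difference quotients converge and that their limit is d. *)
definition has_dir_deriv ::
    "('a::real_normed_vector \<Rightarrow> real) \<Rightarrow> 'a \<Rightarrow> 'a \<Rightarrow> real \<Rightarrow> bool" where
  "has_dir_deriv g x v d \<longleftrightarrow>
     ((\<lambda>\<delta>. (g (x + \<delta> *\<^sub>R v) - g x) / \<delta>) \<longlongrightarrow> d) (at_right 0)"

(* For convex X the defining condition only involves the values of g on X. *)
definition d_stationary :: "('a::real_normed_vector \<Rightarrow> real) \<Rightarrow> 'a set \<Rightarrow> 'a set" where
  "d_stationary g X =
     {xbar \<in> X. \<forall>x\<in>X. \<exists>d. has_dir_deriv g xbar (x - xbar) d \<and> 0 \<le> d}"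

(* The matrix Q is arbitrary, so convexity is never implicit and degree at most one is included;
   affine functions are the case Q = 0. *)
definition quadratic_fun :: "(real ^ 'n \<Rightarrow> real) \<Rightarrow> bool" where
  "quadratic_fun q \<longleftrightarrow>
     (\<exists>(Q :: real ^ 'n ^ 'n) c d. \<forall>x. q x = x \<bullet> (Q *v x) + c \<bullet> x + d)"

definition affine_fun :: "(real ^ 'n \<Rightarrow> real) \<Rightarrow> bool" where
  "affine_fun h \<longleftrightarrow> (\<exists>c d. \<forall>x. h x = c \<bullet> x + d)"

definition piecewise_affine :: "(real ^ 'n \<Rightarrow> real) \<Rightarrow> bool" where
  "piecewise_affine g \<longleftrightarrow>
     continuous_on UNIV g \<and>
     (\<exists>H. finite H \<and> (\<forall>h\<in>H. affine_fun h) \<and> (\<forall>x. \<exists>h\<in>H. g x = h x))"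

(* The set D is the domain of the function, whose values outside D are irrelevant. *)
definition piecewise_linear_quadratic_on ::
    "(real ^ 'n) set \<Rightarrow> (real ^ 'n \<Rightarrow> real) \<Rightarrow> bool" where
  "piecewise_linear_quadratic_on D g \<longleftrightarrow>
     continuous_on D g \<and>
     (\<exists>\<P>. finite \<P> \<and> D = \<Union>\<P> \<and>
        (\<forall>P\<in>\<P>. polyhedron P \<and> (\<exists>q. quadratic_fun q \<and> (\<forall>x\<in>P. g x = q x))))"

definition strictly_convex_on :: "'a::real_vector set \<Rightarrow> ('a \<Rightarrow> real) \<Rightarrow> bool" where
  "strictly_convex_on S f \<longleftrightarrow> convex S \<and>
     (\<forall>x\<in>S. \<forall>y\<in>S. \<forall>u>0. \<forall>v>0. x \<noteq> y \<longrightarrow> u + v = 1 \<longrightarrow>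
        f (u *\<^sub>R x + v *\<^sub>R y) < u * f x + v * f y)"

(* Meaningful only where f is differentiable, in which case the gradient is unique. *)
definition gradient :: "('a::real_inner \<Rightarrow> real) \<Rightarrow> 'a \<Rightarrow> 'a" where
  "gradient f x = (THE D. GDERIV f x :> D)"

(* Linear independence of an indexed family: a repeated vector makes the family dependent,
   which "independent" applied to the image alone would not detect. *)
definition independent_family :: "('i \<Rightarrow> 'a::real_vector) \<Rightarrow> 'i set \<Rightarrow> bool" where
  "independent_family G I \<longleftrightarrow> inj_on G I \<and> independent (G ` I)"

definition active_set :: "nat \<Rightarrow> (nat \<Rightarrow> 'a \<Rightarrow> real) \<Rightarrow> 'a \<Rightarrow> nat set" where
  "active_set k p x = {i. is_arg_max (\<lambda>i. p i x) (\<lambda>i. i \<in> {1..k}) i}"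

definition plq_on_superset :: "(real ^ 'n) set \<Rightarrow> (real ^ 'n \<Rightarrow> real) \<Rightarrow> bool" where
  "plq_on_superset X \<psi> \<longleftrightarrow> (\<exists>D. X \<subseteq> D \<and> piecewise_linear_quadratic_on D \<psi>)"

definition affine_plus_max_convex_quadratic :: "(real ^ 'n \<Rightarrow> real) \<Rightarrow> bool" where
  "affine_plus_max_convex_quadratic \<psi> \<longleftrightarrow>
     (\<exists>\<psi>1 (k2::nat) \<psi>2.
        1 \<le> k2 \<and> piecewise_affine \<psi>1 \<and>
        (\<forall>i\<in>{1..k2}. quadratic_fun (\<psi>2 i) \<and> convex_on UNIV (\<psi>2 i)) \<and>
        (\<forall>x. \<psi> x = \<psi>1 x + Max ((\<lambda>i. \<psi>2 i x) ` {1..k2})))"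

definition max2_minus_max2_quadratic :: "(real ^ 'n \<Rightarrow> real) \<Rightarrow> bool" where
  "max2_minus_max2_quadratic \<psi> \<longleftrightarrow>
     (\<exists>\<psi>11 \<psi>12 \<psi>21 \<psi>22.
        quadratic_fun \<psi>11 \<and> quadratic_fun \<psi>12 \<and> quadratic_fun \<psi>21 \<and> quadratic_fun \<psi>22 \<and>
        (\<forall>x. \<psi> x = max (\<psi>11 x) (\<psi>12 x) - max (\<psi>21 x) (\<psi>22 x)))"

definition max_concave_minus_max_strictly_convex ::
    "(real ^ 'n) set \<Rightarrow> (real ^ 'n \<Rightarrow> real) \<Rightarrow> bool" where
  "max_concave_minus_max_strictly_convex X \<psi> \<longleftrightarrow>
     (\<exists>(k1::nat) (k2::nat) \<psi>1 \<psi>2.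
        1 \<le> k1 \<and> 1 \<le> k2 \<and>
        (\<forall>i\<in>{1..k1}. quadratic_fun (\<psi>1 i) \<and> concave_on UNIV (\<psi>1 i)) \<and>
        (\<forall>i\<in>{1..k2}. quadratic_fun (\<psi>2 i) \<and> strictly_convex_on UNIV (\<psi>2 i)) \<and>
        (\<forall>x. \<psi> x = Max ((\<lambda>i. \<psi>1 i x) ` {1..k1}) - Max ((\<lambda>i. \<psi>2 i x) ` {1..k2})) \<and>
        (\<forall>xbar \<in> d_stationary \<psi> X.
           independent_family (\<lambda>i. gradient (\<psi>1 i) xbar) (active_set k1 \<psi>1 xbar)))"

end

theory Submission
  imports Defs "HOL-Computational_Algebra.Polynomial_Factorial"
begin

text \<open>
  Each class of inner functions \<open>\<psi>\<close> consists of continuous selections of finitely many quadratic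
  functions on X, hence is directionally differentiable. If x is stationary for \<open>\<phi> \<circ> \<psi>\<close>, then
  either \<open>\<phi>\<close> has a global extremum at \<open>\<psi> x\<close>, or x is stationary for \<open>\<psi>\<close> or for \<open>- \<psi>\<close>
  (\<open>composite_stationary_imp\<close>): near a point where it is not extremal, a convex or concave function
  lies, on one side, below an affine function that agrees with it at the point and decreases away from
  it. Since \<open>\<phi>\<close> has at most one minimum value and one maximum value, it suffices to count the stationary values of \<open>\<psi>\<close> and \<open>- \<psi>\<close>.

  The polyhedra involved are refined into the finitely many relatively open cells of a hyperplane
  arrangement. Inside its cell, a stationary point x can be moved in both directions. Therefore, if a
  quadratic majorant q touches \<open>\<psi>\<close> at two stationary points of one cell, the slope of q along their
  connecting line vanishes at both, and because the increment of a quadratic function is the mean of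
  its end slopes, the two values agree (\<open>stationary_values_eq_on_cell\<close>). This settles piecewise
  linear-quadratic functions and every situation in which one active piece bounds the function from
  above. If instead the touching majorant is convex on X or on the cell, the stationary point minimizes it
  there (\<open>stationary_convex_majorant\<close>), and there is one value for each such majorant. For a maximum
  of concave minus a maximum of convex quadratics, two stationary points x and y of one cell with the
  same active pieces are compared: some active difference of pieces has nonnegative slope at y in the
  direction away from x, and its concavity gives \<open>\<psi> x \<le> \<psi> y\<close>.

  The remaining case is a difference of two maxima of two arbitrary quadratics with both pieces of
  the first maximum active. Here the stationary points are critical points of a pencil \<open>q + t r\<close> on
  the set \<open>r = 0\<close> with varying multiplier t. By a generalized inverse of the pencil with polynomial
  entries, the critical value of \<open>q + t r\<close> is a rational function of t whose derivative is the value of r,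
  which is zero at every multiplier that occurs. If there are infinitely many of these, the rational
  function is constant; otherwise each of them contributes one value
  (\<open>finite_critical_values_on_zero_set\<close>).
\<close>

section \<open>Slopes of quadratic functions\<close>

text \<open>
  A central difference quotient with step one. For a quadratic function it equals the directional
  derivative of q at x along v exactly, which makes first order reasoning purely algebraic.
\<close>
definition slope :: "('a::real_vector \<Rightarrow> real) \<Rightarrow> 'a \<Rightarrow> 'a \<Rightarrow> real" where
  "slope q x v = (q (x + v) - q (x - v)) / 2"

lemma slope_minus: "slope q x (- v) = - slope q x v"
  by (simp add: slope_def field_simps)

lemma quadratic_fun_along_line:
  assumes "quadratic_fun q"
  shows "q (x + t *\<^sub>R v) = q x + t * slope q x v + t\<^sup>2 * ((q (x + v) + q (x - v)) / 2 - q x)"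
proof -
  obtain Q c d where q: "\<And>x. q x = x \<bullet> (Q *v x) + c \<bullet> x + d"
    using assms unfolding quadratic_fun_def by blast
  show ?thesis
    unfolding slope_def q
    by (simp add: matrix_vector_right_distrib matrix_vector_mult_diff_distrib
        matrix_vector_mult_scaleR inner_add_left inner_add_right inner_diff_left inner_diff_right
        power2_eq_square field_simps)
qed

text \<open>
  The trapezoidal rule is exact for quadratic functions. Hence two points at which the slopes along
  the connecting line vanish have the same value, whatever the curvature between them.
\<close>
lemma quadratic_fun_increment:
  assumes "quadratic_fun q"
  shows "q y - q x = (slope q x (y - x) + slope q y (y - x)) / 2"
proof -
  define k where "k = (q (x + (y - x)) + q (x - (y - x))) / 2 - q x"
  have "y + (y - x) = x + 2 *\<^sub>R (y - x)" by (simp add: scaleR_2)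
  then have "q (y + (y - x)) = q x + 2 * slope q x (y - x) + 4 * k"
    using quadratic_fun_along_line[OF assms, of x 2 "y - x"] by (simp only: k_def) simp
  moreover have "q y = q x + slope q x (y - x) + k"
    using quadratic_fun_along_line[OF assms, of x 1 "y - x"] by (simp only: k_def) simp
  moreover have "slope q y (y - x) = (q (y + (y - x)) - q x) / 2"
    by (simp add: slope_def)
  ultimately show ?thesis by simp
qed

lemma quadratic_fun_continuous:
  assumes "quadratic_fun q"
  shows "continuous_on S q"
proof -
  obtain Q c d where "\<And>x. q x = x \<bullet> (Q *v x) + c \<bullet> x + d"
    using assms unfolding quadratic_fun_def by blast
  then have "q = (\<lambda>x. x \<bullet> (Q *v x) + c \<bullet> x + d)" by auto
  then show ?thesis by (auto intro!: continuous_intros)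
qed

lemma quadratic_fun_slope_tendsto:
  assumes "quadratic_fun q"
  shows "((\<lambda>t. (q (x + t *\<^sub>R v) - q x) / t) \<longlongrightarrow> slope q x v) (at_right 0)"
proof -
  define k where "k = (q (x + v) + q (x - v)) / 2 - q x"
  have "((\<lambda>t. slope q x v + t * k) \<longlongrightarrow> slope q x v + 0 * k) (at_right 0)"
    by (intro tendsto_intros)
  moreover have "\<forall>\<^sub>F t in at_right 0. slope q x v + t * k = (q (x + t *\<^sub>R v) - q x) / t"
    unfolding eventually_at_right_field
    by (intro exI[of _ 1]) (auto simp: quadratic_fun_along_line[OF assms, of x] k_def power2_eq_square field_simps)
  ultimately show ?thesis by (simp add: tendsto_cong)
qed

lemma quadratic_fun_add:
  assumes "quadratic_fun p" "quadratic_fun q"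
  shows "quadratic_fun (\<lambda>x. p x + q x)"
proof -
  from assms(1) obtain P c d where "\<And>x. p x = x \<bullet> (P *v x) + c \<bullet> x + d"
    unfolding quadratic_fun_def by blast
  moreover from assms(2) obtain Q e f where "\<And>x. q x = x \<bullet> (Q *v x) + e \<bullet> x + f"
    unfolding quadratic_fun_def by blast
  ultimately have "p x + q x = x \<bullet> ((P + Q) *v x) + (c + e) \<bullet> x + (d + f)" for x
    by (simp add: matrix_vector_mult_add_rdistrib inner_add_left inner_add_right)
  then show ?thesis unfolding quadratic_fun_def by blast
qed

lemma quadratic_fun_uminus:
  assumes "quadratic_fun p"
  shows "quadratic_fun (\<lambda>x. - p x)"
proof -
  from assms obtain P c d where "\<And>x. p x = x \<bullet> (P *v x) + c \<bullet> x + d"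
    unfolding quadratic_fun_def by blast
  moreover have "(- P) *v x = - (P *v x)" for x
    using matrix_vector_mult_diff_rdistrib[of 0 P x] by simp
  ultimately have "- p x = x \<bullet> ((- P) *v x) + (- c) \<bullet> x + (- d)" for x by simp
  then show ?thesis unfolding quadratic_fun_def by blast
qed

lemma quadratic_fun_diff:
  "quadratic_fun p \<Longrightarrow> quadratic_fun q \<Longrightarrow> quadratic_fun (\<lambda>x. p x - q x)"
  using quadratic_fun_add[OF _ quadratic_fun_uminus] by fastforce

lemma affine_fun_quadratic:
  assumes "affine_fun h"
  shows "quadratic_fun h"
proof -
  from assms obtain c d where "\<And>x. h x = c \<bullet> x + d" unfolding affine_fun_def by blast
  then have "h x = x \<bullet> (0 *v x) + c \<bullet> x + d" for x by simp
  then show ?thesis unfolding quadratic_fun_def by blast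
qed

lemma affine_fun_convex:
  assumes "affine_fun h"
  shows "convex_on UNIV h"
proof -
  from assms obtain c d where "\<And>x. h x = c \<bullet> x + d" unfolding affine_fun_def by blast
  then show ?thesis by (intro convex_onI) (auto simp: inner_add_right algebra_simps)
qed

section \<open>Stationary points touched by majorants\<close>

text \<open>
  Stationarity speaks about targets x in X. Rescaling the difference quotient turns it into a
  statement about every direction along which X is entered.
\<close>
lemma stationary_direction:
  assumes "x \<in> d_stationary \<psi> X" "\<forall>\<^sub>F t in at_right 0. x + t *\<^sub>R v \<in> X"
  shows "\<exists>d\<ge>0. has_dir_deriv \<psi> x v d"
proof -
  obtain b where "b > 0" "\<And>t. 0 < t \<Longrightarrow> t < b \<Longrightarrow> x + t *\<^sub>R v \<in> X"
    using assms(2) unfolding eventually_at_right_field by auto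
  then have "b / 2 > 0" "x + (b / 2) *\<^sub>R v \<in> X" by auto
  then obtain s where s: "s > 0" "x + s *\<^sub>R v \<in> X" by blast
  have "(x + s *\<^sub>R v) - x = s *\<^sub>R v" by simp
  moreover have "\<exists>d. has_dir_deriv \<psi> x ((x + s *\<^sub>R v) - x) d \<and> 0 \<le> d"
    using assms(1) s(2) unfolding d_stationary_def by blast
  ultimately obtain d where d: "has_dir_deriv \<psi> x (s *\<^sub>R v) d" "0 \<le> d" by auto
  have "filterlim (\<lambda>t. (1 / s) * t) (at_right 0) (at_right 0)"
    by (rule filterlim_times_pos[OF filterlim_ident]) (use s(1) in auto)
  from filterlim_compose[OF d(1)[unfolded has_dir_deriv_def] this]
  have "((\<lambda>t. (\<psi> (x + t *\<^sub>R v) - \<psi> x) / t * s) \<longlongrightarrow> d) (at_right 0)"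
    using s(1) by (simp add: field_simps)
  from tendsto_mult_right[OF this, of "1 / s"]
  have "((\<lambda>t. (\<psi> (x + t *\<^sub>R v) - \<psi> x) / t) \<longlongrightarrow> d / s) (at_right 0)"
    using s(1) by simp
  then show ?thesis
    using d(2) s(1) by (intro exI[of _ "d / s"]) (auto simp: has_dir_deriv_def)
qed

lemma has_dir_deriv_tendsto:
  assumes "has_dir_deriv \<psi> x v d"
  shows "((\<lambda>t. \<psi> (x + t *\<^sub>R v)) \<longlongrightarrow> \<psi> x) (at_right 0)"
proof -
  have "((\<lambda>t. \<psi> x + t * ((\<psi> (x + t *\<^sub>R v) - \<psi> x) / t)) \<longlongrightarrow> \<psi> x + 0 * d) (at_right 0)"
    using assms unfolding has_dir_deriv_def by (intro tendsto_intros)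
  moreover have "\<forall>\<^sub>F t::real in at_right 0. \<psi> x + t * ((\<psi> (x + t *\<^sub>R v) - \<psi> x) / t) = \<psi> (x + t *\<^sub>R v)"
    unfolding eventually_at_right_field by (intro exI[of _ 1]) auto
  ultimately show ?thesis by (simp add: tendsto_cong)
qed

text \<open>
  The basic consequence of stationarity: if near x, along the direction v, the function stays below
  the maximum of finitely many quadratics that do not exceed it at x, then one of these touches it
  at x and does not decrease along v. Otherwise each of them would fall strictly below \<open>\<psi>\<close>
  for all small steps, either by continuity or by comparing slopes.
\<close>
lemma stationary_active_slope:
  assumes stat: "x \<in> d_stationary \<psi> X" and dir: "\<forall>\<^sub>F t in at_right 0. x + t *\<^sub>R v \<in> X"
    and I: "finite I" "\<And>i. i \<in> I \<Longrightarrow> quadratic_fun (p i)" "\<And>i. i \<in> I \<Longrightarrow> p i x \<le> \<psi> x"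
    and major: "\<forall>\<^sub>F t in at_right 0. \<exists>i\<in>I. \<psi> (x + t *\<^sub>R v) \<le> p i (x + t *\<^sub>R v)"
  shows "\<exists>i\<in>I. p i x = \<psi> x \<and> 0 \<le> slope (p i) x v"
proof (rule ccontr)
  assume neg: "\<not> ?thesis"
  obtain d where d: "0 \<le> d" "has_dir_deriv \<psi> x v d" using stationary_direction[OF stat dir] by blast
  have "\<forall>\<^sub>F t in at_right 0. p i (x + t *\<^sub>R v) < \<psi> (x + t *\<^sub>R v)" if i: "i \<in> I" for i
  proof (cases "p i x = \<psi> x")
    case True
    have "((\<lambda>t. (\<psi> (x + t *\<^sub>R v) - \<psi> x) / t - (p i (x + t *\<^sub>R v) - p i x) / t)
        \<longlongrightarrow> d - slope (p i) x v) (at_right 0)"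
      by (intro tendsto_diff quadratic_fun_slope_tendsto I(2) i d(2)[unfolded has_dir_deriv_def])
    moreover have "d - slope (p i) x v > 0" using neg True i d(1) by force
    ultimately have "\<forall>\<^sub>F t in at_right 0.
        0 < (\<psi> (x + t *\<^sub>R v) - \<psi> x) / t - (p i (x + t *\<^sub>R v) - p i x) / t"
      by (rule order_tendstoD(1))
    moreover have "\<forall>\<^sub>F t::real in at_right 0. t > 0" by (simp add: eventually_at_right_less)
    ultimately show ?thesis
    proof eventually_elim
      case (elim t)
      have "(\<psi> (x + t *\<^sub>R v) - \<psi> x) / t - (p i (x + t *\<^sub>R v) - p i x) / t
          = (\<psi> (x + t *\<^sub>R v) - p i (x + t *\<^sub>R v)) / t"
        using True by (simp add: diff_divide_distrib)
      with elim show ?case by (simp add: zero_less_divide_iff)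
    qed
  next
    case False
    have "has_dir_deriv (p i) x v (slope (p i) x v)"
      unfolding has_dir_deriv_def by (rule quadratic_fun_slope_tendsto[OF I(2)[OF i]])
    then have "((\<lambda>t. \<psi> (x + t *\<^sub>R v) - p i (x + t *\<^sub>R v)) \<longlongrightarrow> \<psi> x - p i x) (at_right 0)"
      using d(2) by (intro tendsto_diff has_dir_deriv_tendsto)
    moreover have "\<psi> x - p i x > 0" using False I(3)[OF i] by simp
    ultimately have "\<forall>\<^sub>F t in at_right 0. 0 < \<psi> (x + t *\<^sub>R v) - p i (x + t *\<^sub>R v)"
      by (rule order_tendstoD(1))
    then show ?thesis by (rule eventually_mono) simp
  qed
  then have "\<forall>\<^sub>F t in at_right 0. \<forall>i\<in>I. p i (x + t *\<^sub>R v) < \<psi> (x + t *\<^sub>R v)"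
    using I(1) by (simp add: eventually_ball_finite)
  with major have "\<forall>\<^sub>F t::real in at_right 0. False"
    by eventually_elim (meson leD)
  then show False by simp
qed

text \<open>
  A convex majorant that touches at a stationary point cannot decrease towards a point of X \<open>\<inter>\<close> C,
  because its difference quotients are bounded by its total increment.
\<close>
lemma stationary_convex_majorant:
  assumes "x \<in> d_stationary \<psi> X" "y \<in> X" "convex_on C p" "x \<in> C" "y \<in> C"
    and "\<And>z. z \<in> C \<Longrightarrow> \<psi> z \<le> p z" "\<psi> x = p x"
  shows "p x \<le> p y"
proof -
  obtain d where d: "has_dir_deriv \<psi> x (y - x) d" "0 \<le> d"
    using assms(1,2) unfolding d_stationary_def by blast
  have "(\<psi> (x + t *\<^sub>R (y - x)) - \<psi> x) / t \<le> p y - p x" if "0 < t" "t < 1" for t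
  proof -
    have z: "x + t *\<^sub>R (y - x) = (1 - t) *\<^sub>R x + t *\<^sub>R y" by (simp add: algebra_simps)
    have "x + t *\<^sub>R (y - x) \<in> C"
      using that assms(3-5) unfolding z by (intro convexD) (auto dest: convex_on_imp_convex)
    then have "\<psi> (x + t *\<^sub>R (y - x)) \<le> p (x + t *\<^sub>R (y - x))" by (rule assms(6))
    also have "\<dots> \<le> (1 - t) * p x + t * p y"
      unfolding z using that assms(3-5) by (intro convex_onD) auto
    finally have "\<psi> (x + t *\<^sub>R (y - x)) - \<psi> x \<le> t * (p y - p x)"
      using assms(7) by (simp add: algebra_simps)
    then show ?thesis using that by (simp add: pos_divide_le_eq mult.commute)
  qed
  then have "\<forall>\<^sub>F t in at_right 0. (\<psi> (x + t *\<^sub>R (y - x)) - \<psi> x) / t \<le> p y - p x"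
    unfolding eventually_at_right_field by (intro exI[of _ 1]) auto
  with d(1) have "d \<le> p y - p x"
    unfolding has_dir_deriv_def by (intro tendsto_upperbound) auto
  then show ?thesis using d(2) by simp
qed

section \<open>Composition with a convex or concave function\<close>

lemma convex_on_three_points:
  fixes \<phi> :: "real \<Rightarrow> real"
  assumes "convex_on UNIV \<phi>" "a < b" "b < c"
  shows "(c - a) * \<phi> b \<le> (c - b) * \<phi> a + (b - a) * \<phi> c"
proof -
  define t where "t = (b - a) / (c - a)"
  have t: "0 \<le> t" "t \<le> 1" "(1 - t) * (c - a) = c - b" "t * (c - a) = b - a"
    using assms(2,3) by (auto simp: t_def field_simps)
  then have "b = (1 - t) *\<^sub>R a + t *\<^sub>R c" by (simp add: algebra_simps)
  then have "\<phi> b \<le> (1 - t) * \<phi> a + t * \<phi> c"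
    using convex_onD[OF assms(1) t(1,2)] by auto
  then have "(c - a) * \<phi> b \<le> (c - a) * ((1 - t) * \<phi> a + t * \<phi> c)"
    using assms(2,3) by (intro mult_left_mono) auto
  also have "\<dots> = ((1 - t) * (c - a)) * \<phi> a + (t * (c - a)) * \<phi> c" by (simp add: algebra_simps)
  finally show ?thesis unfolding t(3,4) .
qed

text \<open>
  Away from its global extrema, a convex or concave function has, on one side of s at least, an
  affine upper bound through s that is a genuine descent direction. A convex function lies below the
  chord to a point with smaller value, on the side of that point; a concave one lies below the
  extension of the chord to a point with larger value, on the opposite side.
\<close>
lemma convex_or_concave_slope:
  fixes \<phi> :: "real \<Rightarrow> real"
  assumes \<phi>: "convex_on UNIV \<phi> \<or> concave_on UNIV \<phi>"
    and nomin: "\<not> (\<forall>u. \<phi> s \<le> \<phi> u)" and nomax: "\<not> (\<forall>u. \<phi> u \<le> \<phi> s)"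
  shows "(\<exists>k>0. \<forall>\<^sub>F u in at_left s. \<phi> u \<le> \<phi> s + k * (u - s)) \<or>
         (\<exists>k<0. \<forall>\<^sub>F u in at_right s. \<phi> u \<le> \<phi> s + k * (u - s))"
  using \<phi>
proof
  assume conv: "convex_on UNIV \<phi>"
  obtain w where w: "\<phi> w < \<phi> s" using nomin by (auto simp: not_le)
  define k where "k = (\<phi> w - \<phi> s) / (w - s)"
  have "w \<noteq> s" using w by auto
  then have k: "k * (w - s) = \<phi> w - \<phi> s" by (simp add: k_def)
  show ?thesis
  proof (cases "w < s")
    case True
    have "\<phi> u \<le> \<phi> s + k * (u - s)" if "w < u" "u < s" for u
    proof (rule mult_left_le_imp_le[of "s - w"])
      have "(s - w) * (\<phi> s + k * (u - s)) = (s - w) * \<phi> s - (k * (w - s)) * (u - s)"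
        by (simp add: algebra_simps)
      then show "(s - w) * \<phi> u \<le> (s - w) * (\<phi> s + k * (u - s))"
        using convex_on_three_points[OF conv that] unfolding k by (simp add: algebra_simps)
    qed (use True in simp)
    then have "\<forall>\<^sub>F u in at_left s. \<phi> u \<le> \<phi> s + k * (u - s)"
      unfolding eventually_at_left_field using True by blast
    moreover have "k > 0" using w True by (simp add: k_def divide_neg_neg)
    ultimately show ?thesis by blast
  next
    case False
    then have "s < w" using \<open>w \<noteq> s\<close> by simp
    have "\<phi> u \<le> \<phi> s + k * (u - s)" if "s < u" "u < w" for u
    proof (rule mult_left_le_imp_le[of "w - s"])
      have "(w - s) * (\<phi> s + k * (u - s)) = (w - s) * \<phi> s + (k * (w - s)) * (u - s)"
        by (simp add: algebra_simps)
      then show "(w - s) * \<phi> u \<le> (w - s) * (\<phi> s + k * (u - s))"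
        using convex_on_three_points[OF conv that] unfolding k by (simp add: algebra_simps)
    qed (use \<open>s < w\<close> in simp)
    then have "\<forall>\<^sub>F u in at_right s. \<phi> u \<le> \<phi> s + k * (u - s)"
      unfolding eventually_at_right_field using \<open>s < w\<close> by blast
    moreover have "k < 0" using w \<open>s < w\<close> by (simp add: k_def divide_neg_pos)
    ultimately show ?thesis by blast
  qed
next
  assume "concave_on UNIV \<phi>"
  then have conc: "convex_on UNIV (\<lambda>u. - \<phi> u)" by (simp add: concave_on_def)
  obtain w where w: "\<phi> s < \<phi> w" using nomax by (auto simp: not_le)
  define k where "k = (\<phi> w - \<phi> s) / (w - s)"
  have "w \<noteq> s" using w by auto
  then have k: "k * (w - s) = \<phi> w - \<phi> s" by (simp add: k_def)
  show ?thesis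
  proof (cases "s < w")
    case True
    have "\<phi> u \<le> \<phi> s + k * (u - s)" if "u < s" for u
    proof (rule mult_left_le_imp_le[of "w - s"])
      have "(w - s) * (\<phi> s + k * (u - s)) = (w - s) * \<phi> s + (k * (w - s)) * (u - s)"
        by (simp add: algebra_simps)
      then show "(w - s) * \<phi> u \<le> (w - s) * (\<phi> s + k * (u - s))"
        using convex_on_three_points[OF conc that True] unfolding k by (simp add: algebra_simps)
    qed (use True in simp)
    then have "\<forall>\<^sub>F u in at_left s. \<phi> u \<le> \<phi> s + k * (u - s)"
      unfolding eventually_at_left_field by (intro exI[of _ "s - 1"]) auto
    moreover have "k > 0" using w True by (simp add: k_def)
    ultimately show ?thesis by blast
  next
    case False
    then have "w < s" using \<open>w \<noteq> s\<close> by simp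
    have "\<phi> u \<le> \<phi> s + k * (u - s)" if "s < u" for u
    proof (rule mult_left_le_imp_le[of "s - w"])
      have "(s - w) * (\<phi> s + k * (u - s)) = (s - w) * \<phi> s - (k * (w - s)) * (u - s)"
        by (simp add: algebra_simps)
      then show "(s - w) * \<phi> u \<le> (s - w) * (\<phi> s + k * (u - s))"
        using convex_on_three_points[OF conc \<open>w < s\<close> that] unfolding k by (simp add: algebra_simps)
    qed (use \<open>w < s\<close> in simp)
    then have "\<forall>\<^sub>F u in at_right s. \<phi> u \<le> \<phi> s + k * (u - s)"
      unfolding eventually_at_right_field by (intro exI[of _ "s + 1"]) auto
    moreover have "k < 0" using w \<open>w < s\<close> by (simp add: k_def divide_pos_neg)
    ultimately show ?thesis by blast
  qed
qed

text \<open>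
  One half of a chain rule, with an affine bound near the inner value in place of a one-sided
  derivative of \<open>\<phi>\<close>.
\<close>
lemma has_dir_deriv_composite_le:
  assumes "has_dir_deriv \<psi> x v d" "has_dir_deriv (\<phi> \<circ> \<psi>) x v e"
    and "filterlim (\<lambda>t. \<psi> (x + t *\<^sub>R v)) F (at_right 0)"
    and "\<forall>\<^sub>F u in F. \<phi> u \<le> \<phi> (\<psi> x) + k * (u - \<psi> x)"
  shows "e \<le> k * d"
proof -
  have "\<forall>\<^sub>F t in at_right 0. \<phi> (\<psi> (x + t *\<^sub>R v)) \<le> \<phi> (\<psi> x) + k * (\<psi> (x + t *\<^sub>R v) - \<psi> x)"
    by (rule eventually_compose_filterlim[OF assms(4,3)])
  moreover have "\<forall>\<^sub>F t::real in at_right 0. t > 0" by (simp add: eventually_at_right_less)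
  ultimately have "\<forall>\<^sub>F t in at_right 0. ((\<phi> \<circ> \<psi>) (x + t *\<^sub>R v) - (\<phi> \<circ> \<psi>) x) / t
      \<le> k * ((\<psi> (x + t *\<^sub>R v) - \<psi> x) / t)"
  proof eventually_elim
    case (elim t)
    then have "((\<phi> \<circ> \<psi>) (x + t *\<^sub>R v) - (\<phi> \<circ> \<psi>) x) / t \<le> (k * (\<psi> (x + t *\<^sub>R v) - \<psi> x)) / t"
      by (intro divide_right_mono) auto
    then show ?case by simp
  qed
  then show ?thesis
    using assms(1,2) unfolding has_dir_deriv_def
    by (intro tendsto_le[OF _ tendsto_mult[OF tendsto_const]]) auto
qed

text \<open>
  If \<open>\<psi>\<close> could both decrease and increase from x, the affine bound of \<open>convex_or_concave_slope\<close>
  would give \<open>\<phi> \<circ> \<psi>\<close> a strictly negative derivative along one of the two directions.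
\<close>
lemma composite_stationary_imp:
  fixes \<phi> :: "real \<Rightarrow> real"
  assumes \<phi>: "convex_on UNIV \<phi> \<or> concave_on UNIV \<phi>"
    and dd: "\<And>x y. x \<in> X \<Longrightarrow> y \<in> X \<Longrightarrow> \<exists>d. has_dir_deriv \<psi> x (y - x) d"
    and x: "x \<in> d_stationary (\<phi> \<circ> \<psi>) X"
    and ext: "\<not> (\<forall>u. \<phi> (\<psi> x) \<le> \<phi> u)" "\<not> (\<forall>u. \<phi> u \<le> \<phi> (\<psi> x))"
  shows "x \<in> d_stationary \<psi> X \<or> x \<in> d_stationary (\<lambda>x. - \<psi> x) X"
proof -
  have xX: "x \<in> X" using x by (simp add: d_stationary_def)
  have composite: "\<exists>e\<ge>0. has_dir_deriv (\<phi> \<circ> \<psi>) x (y - x) e" if "y \<in> X" for y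
    using x that by (auto simp: d_stationary_def)
  have quot: "\<forall>\<^sub>F t::real in at_right 0. t > 0" by (simp add: eventually_at_right_less)
  from convex_or_concave_slope[OF \<phi> ext] show ?thesis
  proof (elim disjE exE conjE)
    fix k :: real assume k: "k > 0" "\<forall>\<^sub>F u in at_left (\<psi> x). \<phi> u \<le> \<phi> (\<psi> x) + k * (u - \<psi> x)"
    have "\<exists>d. has_dir_deriv \<psi> x (y - x) d \<and> 0 \<le> d" if y: "y \<in> X" for y
    proof -
      obtain d where d: "has_dir_deriv \<psi> x (y - x) d" using dd[OF xX y] by blast
      obtain e where e: "0 \<le> e" "has_dir_deriv (\<phi> \<circ> \<psi>) x (y - x) e" using composite[OF y] by blast
      have "0 \<le> d"
      proof (rule ccontr)
        assume "\<not> 0 \<le> d"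
        then have "\<forall>\<^sub>F t in at_right 0. (\<psi> (x + t *\<^sub>R (y - x)) - \<psi> x) / t < 0"
          using d unfolding has_dir_deriv_def by (intro order_tendstoD(2)) auto
        with quot have "\<forall>\<^sub>F t in at_right 0. \<psi> (x + t *\<^sub>R (y - x)) < \<psi> x"
          by eventually_elim (auto simp: divide_less_0_iff)
        then have "filterlim (\<lambda>t. \<psi> (x + t *\<^sub>R (y - x))) (at_left (\<psi> x)) (at_right 0)"
          unfolding filterlim_at using has_dir_deriv_tendsto[OF d] by (auto elim: eventually_mono)
        from has_dir_deriv_composite_le[OF d e(2) this k(2)] have "e \<le> k * d" .
        moreover have "k * d < 0" using k(1) \<open>\<not> 0 \<le> d\<close> by (simp add: mult_pos_neg)
        ultimately show False using e(1) by simp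
      qed
      then show ?thesis using d by blast
    qed
    then show ?thesis using xX by (auto simp: d_stationary_def)
  next
    fix k :: real assume k: "k < 0" "\<forall>\<^sub>F u in at_right (\<psi> x). \<phi> u \<le> \<phi> (\<psi> x) + k * (u - \<psi> x)"
    have "\<exists>d. has_dir_deriv (\<lambda>x. - \<psi> x) x (y - x) d \<and> 0 \<le> d" if y: "y \<in> X" for y
    proof -
      obtain d where d: "has_dir_deriv \<psi> x (y - x) d" using dd[OF xX y] by blast
      obtain e where e: "0 \<le> e" "has_dir_deriv (\<phi> \<circ> \<psi>) x (y - x) e" using composite[OF y] by blast
      have "d \<le> 0"
      proof (rule ccontr)
        assume "\<not> d \<le> 0"
        then have "\<forall>\<^sub>F t in at_right 0. 0 < (\<psi> (x + t *\<^sub>R (y - x)) - \<psi> x) / t"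
          using d unfolding has_dir_deriv_def by (intro order_tendstoD(1)) auto
        with quot have "\<forall>\<^sub>F t in at_right 0. \<psi> (x + t *\<^sub>R (y - x)) > \<psi> x"
          by eventually_elim (auto simp: zero_less_divide_iff)
        then have "filterlim (\<lambda>t. \<psi> (x + t *\<^sub>R (y - x))) (at_right (\<psi> x)) (at_right 0)"
          unfolding filterlim_at using has_dir_deriv_tendsto[OF d] by (auto elim: eventually_mono)
        from has_dir_deriv_composite_le[OF d e(2) this k(2)] have "e \<le> k * d" .
        moreover have "k * d < 0" using k(1) \<open>\<not> d \<le> 0\<close> by (simp add: mult_neg_pos)
        ultimately show False using e(1) by simp
      qed
      moreover have "has_dir_deriv (\<lambda>x. - \<psi> x) x (y - x) (- d)"
        using tendsto_minus[OF d[unfolded has_dir_deriv_def]]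
        by (simp add: has_dir_deriv_def minus_divide_left)
      ultimately show ?thesis by (intro exI[of _ "- d"]) simp
    qed
    then show ?thesis using xX by (auto simp: d_stationary_def)
  qed
qed

lemma finite_composite_values:
  fixes \<phi> :: "real \<Rightarrow> real"
  assumes \<phi>: "convex_on UNIV \<phi> \<or> concave_on UNIV \<phi>"
    and dd: "\<And>x y. x \<in> X \<Longrightarrow> y \<in> X \<Longrightarrow> \<exists>d. has_dir_deriv \<psi> x (y - x) d"
    and fin: "finite (\<psi> ` d_stationary \<psi> X)"
      "finite ((\<lambda>x. - \<psi> x) ` d_stationary (\<lambda>x. - \<psi> x) X)"
  shows "finite ((\<phi> \<circ> \<psi>) ` d_stationary (\<phi> \<circ> \<psi>) X)"
proof -
  define B where "B = range \<phi> \<inter> {m. (\<forall>u. m \<le> \<phi> u)}"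
  define T where "T = range \<phi> \<inter> {m. (\<forall>u. \<phi> u \<le> m)}"
  have one: "finite S" if "\<And>a b. a \<in> S \<Longrightarrow> b \<in> S \<Longrightarrow> a = b" for S :: "real set"
    by (metis that finite.emptyI finite.insertI finite_subset insertI1 subsetI)
  have "finite B" "finite T"
    by (rule one, force simp: B_def T_def intro: antisym)+
  moreover have "(\<phi> \<circ> \<psi>) ` d_stationary (\<phi> \<circ> \<psi>) X \<subseteq> B \<union> T \<union>
      \<phi> ` (\<psi> ` d_stationary \<psi> X) \<union> (\<lambda>u. \<phi> (- u)) ` ((\<lambda>x. - \<psi> x) ` d_stationary (\<lambda>x. - \<psi> x) X)"
  proof (intro image_subsetI)
    fix x assume "x \<in> d_stationary (\<phi> \<circ> \<psi>) X"
    from composite_stationary_imp[OF \<phi> dd this]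
    have "(\<forall>u. \<phi> (\<psi> x) \<le> \<phi> u) \<or> (\<forall>u. \<phi> u \<le> \<phi> (\<psi> x)) \<or>
        x \<in> d_stationary \<psi> X \<or> x \<in> d_stationary (\<lambda>x. - \<psi> x) X" by blast
    then show "(\<phi> \<circ> \<psi>) x \<in> B \<union> T \<union> \<phi> ` (\<psi> ` d_stationary \<psi> X) \<union>
        (\<lambda>u. \<phi> (- u)) ` ((\<lambda>x. - \<psi> x) ` d_stationary (\<lambda>x. - \<psi> x) X)"
      by (auto simp: B_def T_def image_image)
  qed
  ultimately show ?thesis using fin by (meson finite_subset finite_UnI finite_imageI)
qed

section \<open>Continuous selections of quadratic functions\<close>

text \<open>
  On a connected set, a continuous selection of finitely many functions whose graphs are pairwise
  identical or disjoint is one of these functions: the sets of agreement are closed and partition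
  the connected set.
\<close>
lemma connected_selection:
  fixes g :: "'a::topological_space \<Rightarrow> real"
  assumes S: "connected S" "S \<noteq> {}" and g: "continuous_on S g"
    and H: "finite H" "\<And>h. h \<in> H \<Longrightarrow> continuous_on S h" "\<And>x. x \<in> S \<Longrightarrow> \<exists>h\<in>H. g x = h x"
    and sep: "\<And>h h'. h \<in> H \<Longrightarrow> h' \<in> H \<Longrightarrow> (\<forall>x\<in>S. h x = h' x) \<or> (\<forall>x\<in>S. h x \<noteq> h' x)"
  shows "\<exists>h\<in>H. \<forall>x\<in>S. g x = h x"
proof -
  obtain x0 where x0: "x0 \<in> S" using S(2) by blast
  then obtain h where h: "h \<in> H" "g x0 = h x0" using H(3) by blast
  define Z where "Z = (\<lambda>h. {x \<in> S. g x - h x = 0})"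
  have Z: "closedin (top_of_set S) (Z h')" if "h' \<in> H" for h'
    unfolding Z_def
    by (rule continuous_closedin_preimage_constant) (intro continuous_intros g H(2) that)
  define N where "N = {h' \<in> H. \<forall>x\<in>S. h' x \<noteq> h x}"
  have "closedin (top_of_set S) (\<Union>(Z ` N))"
    using H(1) Z by (intro closedin_Union) (auto simp: N_def)
  moreover have "\<Union>(Z ` N) = S - Z h"
  proof (intro equalityI subsetI)
    fix x assume "x \<in> \<Union>(Z ` N)"
    then obtain h' where "x \<in> S" "g x = h' x" "h' x \<noteq> h x" by (auto simp: Z_def N_def)
    then show "x \<in> S - Z h" by (auto simp: Z_def)
  next
    fix x assume x: "x \<in> S - Z h"
    then obtain h' where h': "h' \<in> H" "g x = h' x" using H(3) by blast
    then have "h' x \<noteq> h x" using x by (auto simp: Z_def)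
    then have "h' \<in> N" using sep[OF h'(1) h(1)] x h'(1) by (auto simp: N_def)
    then show "x \<in> \<Union>(Z ` N)" using x h' by (auto simp: Z_def)
  qed
  ultimately have "openin (top_of_set S) (Z h)"
    by (simp add: openin_closedin_eq Z_def)
  with Z[OF h(1)] S(1) have "Z h = {} \<or> Z h = S" by (simp add: connected_clopen)
  moreover have "x0 \<in> Z h" using x0 h by (simp add: Z_def)
  ultimately have "Z h = S" by blast
  then have "\<forall>x\<in>S. g x = h x" by (auto simp: Z_def)
  then show ?thesis using h(1) by blast
qed

text \<open>
  The common shape of all functions considered here. It yields directional differentiability, since
  along a segment a continuous selection of finitely many quadratic polynomials is eventually one
  of them.
\<close>
definition quadratic_selection_on :: "(real ^ 'n) set \<Rightarrow> (real ^ 'n \<Rightarrow> real) \<Rightarrow> bool" where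
  "quadratic_selection_on X \<psi> \<longleftrightarrow> continuous_on X \<psi> \<and>
     (\<exists>H. finite H \<and> (\<forall>h\<in>H. quadratic_fun h) \<and> (\<forall>x\<in>X. \<exists>h\<in>H. \<psi> x = h x))"

lemma quadratic_polynomial_eventually_nonzero:
  fixes a b c :: real
  shows "(\<forall>t. a + t * b + t\<^sup>2 * c = 0) \<or> (\<forall>\<^sub>F t in at_right 0. a + t * b + t\<^sup>2 * c \<noteq> 0)"
proof (cases "a = 0 \<and> b = 0 \<and> c = 0")
  case False
  have "[:a, b, c:] \<noteq> 0" using False by auto
  then have "finite {t. poly [:a, b, c:] t = 0}" by (rule poly_roots_finite)
  then have "\<forall>\<^sub>F t in at_right 0. \<forall>s\<in>{t. poly [:a, b, c:] t = 0}. t \<noteq> s"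
    by (intro eventually_ball_finite ballI eventually_neq_at_within)
  then have "\<forall>\<^sub>F t in at_right 0. a + t * b + t\<^sup>2 * c \<noteq> 0"
    by (rule eventually_mono) (auto simp: algebra_simps power2_eq_square)
  then show ?thesis ..
qed auto

lemma quadratic_selection_has_dir_deriv:
  fixes x v :: "real ^ 'n"
  assumes sel: "quadratic_selection_on X \<psi>" and "convex X" "x \<in> X" "y \<in> X"
  shows "\<exists>d. has_dir_deriv \<psi> x (y - x) d"
proof -
  obtain H where H: "finite H" "\<And>h. h \<in> H \<Longrightarrow> quadratic_fun h" "\<And>x. x \<in> X \<Longrightarrow> \<exists>h\<in>H. \<psi> x = h x"
    and cont: "continuous_on X \<psi>"
    using sel unfolding quadratic_selection_on_def by blast
  define l where "l = (\<lambda>t::real. x + t *\<^sub>R (y - x))"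
  have lX: "l t \<in> X" if "0 \<le> t" "t \<le> 1" for t
  proof -
    have "l t = (1 - t) *\<^sub>R x + t *\<^sub>R y" by (simp add: l_def algebra_simps)
    then show ?thesis using assms(2-4) that by (simp add: convexD)
  qed
  have contl: "continuous_on S l" for S unfolding l_def by (intro continuous_intros)
  have pair: "(\<forall>t. h (l t) = h' (l t)) \<or> (\<forall>\<^sub>F t in at_right 0. h (l t) \<noteq> h' (l t))"
    if "h \<in> H" "h' \<in> H" for h h'
  proof -
    define k where "k = (\<lambda>q. (q (x + (y - x)) + q (x - (y - x))) / 2 - q x :: real)"
    have "h (l t) - h' (l t) = (h x - h' x) + t * (slope h x (y - x) - slope h' x (y - x)) + t\<^sup>2 * (k h - k h')" for t
      unfolding l_def quadratic_fun_along_line[OF H(2)[OF that(1)], of x t]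
        quadratic_fun_along_line[OF H(2)[OF that(2)], of x t]
      by (simp add: k_def field_simps)
    with quadratic_polynomial_eventually_nonzero[of "h x - h' x" "slope h x (y - x) - slope h' x (y - x)" "k h - k h'"]
    have "(\<forall>t. h (l t) - h' (l t) = 0) \<or> (\<forall>\<^sub>F t in at_right 0. h (l t) - h' (l t) \<noteq> 0)" by simp
    then show ?thesis by simp
  qed
  \<comment> \<open>Near the start of the segment, two pieces agree identically or nowhere.\<close>
  have "\<forall>\<^sub>F t in at_right 0. \<forall>(h, h')\<in>H \<times> H. (\<forall>t. h (l t) = h' (l t)) \<or> h (l t) \<noteq> h' (l t)"
    using H(1) pair by (intro eventually_ball_finite) (auto elim: eventually_mono)
  then obtain b where b: "b > 0" "\<And>t. 0 < t \<Longrightarrow> t < b \<Longrightarrow>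
      \<forall>(h, h')\<in>H \<times> H. (\<forall>t. h (l t) = h' (l t)) \<or> h (l t) \<noteq> h' (l t)"
    unfolding eventually_at_right_field by auto
  define S where "S = {0<..<min b 1}"
  have S: "connected S" "S \<noteq> {}" using b(1) by (auto simp: S_def)
  have "\<exists>g\<in>(\<lambda>h. h \<circ> l) ` H. \<forall>t\<in>S. (\<psi> \<circ> l) t = g t"
  proof (rule connected_selection[OF S])
    show "continuous_on S (\<psi> \<circ> l)"
      by (intro continuous_on_compose contl continuous_on_subset[OF cont]) (auto simp: S_def intro: lX)
    show "\<And>g. g \<in> (\<lambda>h. h \<circ> l) ` H \<Longrightarrow> continuous_on S g"
      using H(2) by (auto intro!: continuous_on_compose contl quadratic_fun_continuous simp del: o_apply)
    show "\<And>t. t \<in> S \<Longrightarrow> \<exists>g\<in>(\<lambda>h. h \<circ> l) ` H. (\<psi> \<circ> l) t = g t"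
      using H(3) lX by (auto simp: S_def)
    fix g g' assume "g \<in> (\<lambda>h. h \<circ> l) ` H" "g' \<in> (\<lambda>h. h \<circ> l) ` H"
    then show "(\<forall>t\<in>S. g t = g' t) \<or> (\<forall>t\<in>S. g t \<noteq> g' t)"
      using b(2) by (fastforce simp: S_def)
  qed (use H(1) in simp)
  then obtain h where h: "h \<in> H" "\<And>t. t \<in> S \<Longrightarrow> \<psi> (l t) = h (l t)" by auto
  have ev: "\<forall>\<^sub>F t in at_right 0. \<psi> (l t) = h (l t)"
    unfolding eventually_at_right_field using h(2) b(1) by (intro exI[of _ "min b 1"]) (auto simp: S_def)
  have "((\<lambda>t. h (l t)) \<longlongrightarrow> h x) (at_right 0)"
    using quadratic_fun_slope_tendsto[OF H(2)[OF h(1)], of x "y - x"]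
    unfolding l_def by (intro has_dir_deriv_tendsto) (simp add: has_dir_deriv_def)
  moreover have "((\<lambda>t. \<psi> (l t)) \<longlongrightarrow> \<psi> x) (at_right 0)"
  proof -
    have "continuous_on {0..1} (\<psi> \<circ> l)"
      by (intro continuous_on_compose contl continuous_on_subset[OF cont]) (auto intro: lX)
    then have "((\<psi> \<circ> l) \<longlongrightarrow> (\<psi> \<circ> l) 0) (at 0 within {0..1})"
      unfolding continuous_on_def by (rule bspec) simp
    then show ?thesis by (simp add: at_within_Icc_at_right l_def o_def)
  qed
  then have "((\<lambda>t. h (l t)) \<longlongrightarrow> \<psi> x) (at_right 0)"
    using ev by (simp add: tendsto_cong)
  ultimately have "\<psi> x = h x" using tendsto_unique by (metis trivial_limit_at_right_real)
  then have "\<forall>\<^sub>F t in at_right 0. (\<psi> (x + t *\<^sub>R (y - x)) - \<psi> x) / t = (h (x + t *\<^sub>R (y - x)) - h x) / t"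
    using ev by (auto elim: eventually_mono simp: l_def)
  from tendsto_cong[THEN iffD2, OF this quadratic_fun_slope_tendsto[OF H(2)[OF h(1)]]]
  show ?thesis unfolding has_dir_deriv_def by blast
qed

lemma convex_on_Max:
  assumes "finite I" "I \<noteq> {}" "\<And>i. i \<in> I \<Longrightarrow> convex_on S (f i)" "convex S"
  shows "convex_on S (\<lambda>x. Max ((\<lambda>i. f i x) ` I))"
proof (rule convex_onI)
  fix t x y assume t: "0 < t" "t < (1::real)" and xy: "x \<in> S" "y \<in> S"
  show "Max ((\<lambda>i. f i ((1 - t) *\<^sub>R x + t *\<^sub>R y)) ` I)
      \<le> (1 - t) * Max ((\<lambda>i. f i x) ` I) + t * Max ((\<lambda>i. f i y) ` I)"
  proof (rule Max.boundedI)
    fix a assume "a \<in> (\<lambda>i. f i ((1 - t) *\<^sub>R x + t *\<^sub>R y)) ` I"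
    then obtain i where i: "i \<in> I" "a = f i ((1 - t) *\<^sub>R x + t *\<^sub>R y)" by blast
    have "a \<le> (1 - t) * f i x + t * f i y"
      unfolding i(2) using t xy by (intro convex_onD[OF assms(3)[OF i(1)]]) auto
    also have "\<dots> \<le> (1 - t) * Max ((\<lambda>i. f i x) ` I) + t * Max ((\<lambda>i. f i y) ` I)"
      using t i(1) assms(1) by (intro add_mono mult_left_mono) auto
    finally show "a \<le> \<dots>" .
  qed (use assms in auto)
qed fact

lemma continuous_on_Max:
  fixes f :: "'i \<Rightarrow> 'a::topological_space \<Rightarrow> real"
  assumes "finite I" "I \<noteq> {}" "\<And>i. i \<in> I \<Longrightarrow> continuous_on S (f i)"
  shows "continuous_on S (\<lambda>x. Max ((\<lambda>i. f i x) ` I))"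
  using assms
proof (induction I rule: finite_ne_induct)
  case (insert i I)
  have "Max ((\<lambda>i. f i x) ` insert i I) = max (f i x) (Max ((\<lambda>i. f i x) ` I))" for x
    using insert.hyps by simp
  then show ?case using insert by (auto intro!: continuous_on_max)
qed simp

lemma Max_image_attained:
  fixes f :: "'i \<Rightarrow> 'a \<Rightarrow> 'b::linorder"
  assumes "finite I" "I \<noteq> {}"
  shows "\<exists>m. \<forall>x. m x \<in> I \<and> f (m x) x = Max ((\<lambda>i. f i x) ` I)"
proof (rule choice, rule allI)
  fix x
  have "Max ((\<lambda>i. f i x) ` I) \<in> (\<lambda>i. f i x) ` I" using assms by (intro Max_in) auto
  then show "\<exists>i. i \<in> I \<and> f i x = Max ((\<lambda>i. f i x) ` I)" by auto
qed

lemma quadratic_selection_on_Max: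
  assumes "finite I" "I \<noteq> {}" "\<And>i. i \<in> I \<Longrightarrow> quadratic_fun (f i)"
  shows "quadratic_selection_on X (\<lambda>x. Max ((\<lambda>i. f i x) ` I))"
proof -
  from Max_image_attained[OF assms(1,2)]
  obtain m where m: "\<forall>x. m x \<in> I \<and> f (m x) x = Max ((\<lambda>i. f i x) ` I)" ..
  have "\<exists>h\<in>f ` I. Max ((\<lambda>i. f i x) ` I) = h x" for x
    using m by (intro bexI[of _ "f (m x)"]) auto
  then show ?thesis
    unfolding quadratic_selection_on_def using assms
    by (intro conjI continuous_on_Max exI[of _ "f ` I"]) (auto intro: quadratic_fun_continuous)
qed

lemma quadratic_selection_on_add:
  assumes "quadratic_selection_on X f" "quadratic_selection_on X g"
  shows "quadratic_selection_on X (\<lambda>x. f x + g x)"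
proof -
  from assms(1) obtain F where F: "finite F" "\<forall>p\<in>F. quadratic_fun p" "\<forall>x\<in>X. \<exists>p\<in>F. f x = p x"
    unfolding quadratic_selection_on_def by blast
  from assms(2) obtain G where G: "finite G" "\<forall>p\<in>G. quadratic_fun p" "\<forall>x\<in>X. \<exists>p\<in>G. g x = p x"
    unfolding quadratic_selection_on_def by blast
  define H where "H = (\<lambda>(p, q). (\<lambda>x. p x + q x)) ` (F \<times> G)"
  have "\<exists>h\<in>H. f x + g x = h x" if "x \<in> X" for x
  proof -
    from F(3) that obtain p where "p \<in> F" "f x = p x" by blast
    moreover from G(3) that obtain q where "q \<in> G" "g x = q x" by blast
    ultimately have "(\<lambda>x. p x + q x) \<in> H" "f x + g x = p x + q x" by (auto simp: H_def)
    then show ?thesis by (intro bexI[of _ "\<lambda>x. p x + q x"])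
  qed
  moreover have "finite H" "\<forall>h\<in>H. quadratic_fun h"
    using F(1,2) G(1,2) by (auto simp: H_def quadratic_fun_add)
  moreover have "continuous_on X (\<lambda>x. f x + g x)"
    using assms unfolding quadratic_selection_on_def by (intro continuous_on_add) blast+
  ultimately show ?thesis unfolding quadratic_selection_on_def by blast
qed

lemma quadratic_selection_on_uminus:
  assumes "quadratic_selection_on X f"
  shows "quadratic_selection_on X (\<lambda>x. - f x)"
proof -
  from assms obtain F where F: "finite F" "\<forall>p\<in>F. quadratic_fun p" "\<forall>x\<in>X. \<exists>p\<in>F. f x = p x"
    unfolding quadratic_selection_on_def by blast
  have "\<exists>h\<in>(\<lambda>p x. - p x) ` F. - f x = h x" if "x \<in> X" for x using F(3) that by auto
  moreover have "\<forall>h\<in>(\<lambda>p x. - p x) ` F. quadratic_fun h" using F(2) quadratic_fun_uminus by auto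
  moreover have "continuous_on X (\<lambda>x. - f x)"
    using assms unfolding quadratic_selection_on_def by (intro continuous_on_minus) blast
  ultimately show ?thesis unfolding quadratic_selection_on_def using F(1) by blast
qed

section \<open>Cells of a hyperplane arrangement\<close>

text \<open>
  The position of x relative to the affine functions \<open>a \<bullet> x - b\<close> with (a, b) in A, encoded by the
  pairs that are negative and those that vanish at x. The points with a given signature form a
  relatively open cell of the arrangement; with finitely many pairs there are finitely many cells.
  These cells replace the relative interiors of faces of polyhedra.
\<close>
definition cell_sig :: "('a::euclidean_space \<times> real) set \<Rightarrow> 'a \<Rightarrow> ('a \<times> real) set \<times> ('a \<times> real) set" where
  "cell_sig A x = ({p \<in> A. fst p \<bullet> x < snd p}, {p \<in> A. fst p \<bullet> x = snd p})"

text \<open>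
  The linear space parallel to the affine hull of the cell of x.
\<close>
definition cell_dirs :: "('a::euclidean_space \<times> real) set \<Rightarrow> 'a \<Rightarrow> 'a set" where
  "cell_dirs A x = {v. \<forall>p\<in>A. fst p \<bullet> x = snd p \<longrightarrow> fst p \<bullet> v = 0}"

definition union_of_cells :: "('a::euclidean_space \<times> real) set \<Rightarrow> 'a set \<Rightarrow> bool" where
  "union_of_cells A P \<longleftrightarrow> (\<forall>x y. cell_sig A x = cell_sig A y \<longrightarrow> x \<in> P \<longrightarrow> y \<in> P)"

lemma cell_sig_eq_iff:
  "cell_sig A x = cell_sig A y \<longleftrightarrow>
     (\<forall>p\<in>A. (fst p \<bullet> x < snd p \<longleftrightarrow> fst p \<bullet> y < snd p) \<and> (fst p \<bullet> x = snd p \<longleftrightarrow> fst p \<bullet> y = snd p))"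
  unfolding cell_sig_def by auto

lemma cell_sig_mono: "cell_sig B x = cell_sig B y \<Longrightarrow> A \<subseteq> B \<Longrightarrow> cell_sig A x = cell_sig A y"
  unfolding cell_sig_eq_iff by blast

lemma union_of_cells_mono: "union_of_cells A P \<Longrightarrow> A \<subseteq> B \<Longrightarrow> union_of_cells B P"
  unfolding union_of_cells_def using cell_sig_mono by blast

lemma finite_cell_sigs: "finite A \<Longrightarrow> finite (cell_sig A ` S)"
  by (rule finite_subset[of _ "Pow A \<times> Pow A"]) (auto simp: cell_sig_def)

lemma cell_dirs_cong: "cell_sig A x = cell_sig A y \<Longrightarrow> cell_dirs A x = cell_dirs A y"
  unfolding cell_sig_eq_iff cell_dirs_def by auto

lemma diff_in_cell_dirs: "cell_sig A x = cell_sig A y \<Longrightarrow> y - x \<in> cell_dirs A x"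
  unfolding cell_sig_eq_iff cell_dirs_def by (auto simp: inner_diff_right)

lemma subspace_cell_dirs: "subspace (cell_dirs A x)"
  unfolding cell_dirs_def subspace_def by (auto simp: inner_add_right)

text \<open>
  Cells are relatively open: a point can be moved both ways along every direction of its cell.
\<close>
lemma cell_sig_along_direction:
  assumes "finite A" "v \<in> cell_dirs A x"
  shows "\<forall>\<^sub>F t in nhds 0. cell_sig A (x + t *\<^sub>R v) = cell_sig A x"
proof -
  have "\<forall>\<^sub>F t in nhds 0. (fst p \<bullet> (x + t *\<^sub>R v) < snd p \<longleftrightarrow> fst p \<bullet> x < snd p) \<and>
      (fst p \<bullet> (x + t *\<^sub>R v) = snd p \<longleftrightarrow> fst p \<bullet> x = snd p)" if p: "p \<in> A" for p
  proof -
    have lim: "((\<lambda>t. fst p \<bullet> (x + t *\<^sub>R v)) \<longlongrightarrow> fst p \<bullet> (x + 0 *\<^sub>R v)) (nhds 0)"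
      by (intro tendsto_intros filterlim_ident)
    consider "fst p \<bullet> x < snd p" | "fst p \<bullet> x > snd p" | "fst p \<bullet> x = snd p" by linarith
    then show ?thesis
    proof cases
      case 1
      with lim have "\<forall>\<^sub>F t in nhds 0. fst p \<bullet> (x + t *\<^sub>R v) < snd p" by (intro order_tendstoD(2)) auto
      then show ?thesis by (rule eventually_mono) (use 1 in auto)
    next
      case 2
      with lim have "\<forall>\<^sub>F t in nhds 0. fst p \<bullet> (x + t *\<^sub>R v) > snd p" by (intro order_tendstoD(1)) auto
      then show ?thesis by (rule eventually_mono) (use 2 in auto)
    next
      case 3
      then have "fst p \<bullet> v = 0" using assms(2) p by (auto simp: cell_dirs_def)
      then show ?thesis using 3 by (simp add: inner_add_right)
    qed
  qed
  then show ?thesis using assms(1) by (simp add: cell_sig_eq_iff eventually_ball_finite)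
qed

lemma convex_cell: "convex {y. cell_sig A y = cell_sig A x}"
proof -
  define C where "C = (\<lambda>p. {y. (fst p \<bullet> y < snd p \<longleftrightarrow> fst p \<bullet> x < snd p) \<and>
      (fst p \<bullet> y = snd p \<longleftrightarrow> fst p \<bullet> x = snd p)})"
  have "convex (C p)" for p
  proof -
    consider "fst p \<bullet> x < snd p" | "fst p \<bullet> x = snd p" | "fst p \<bullet> x > snd p" by linarith
    then show ?thesis
    proof cases
      case 1
      then have "C p = {y. fst p \<bullet> y < snd p}" by (auto simp: C_def)
      then show ?thesis by (simp add: convex_halfspace_lt)
    next
      case 2
      then have "C p = {y. fst p \<bullet> y = snd p}" by (auto simp: C_def)
      then show ?thesis by (simp add: convex_hyperplane)
    next
      case 3
      then have "C p = {y. fst p \<bullet> y > snd p}" by (auto simp: C_def)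
      then show ?thesis by (simp add: convex_halfspace_gt)
    qed
  qed
  then have "convex (\<Inter>p\<in>A. C p)" by (rule convex_INT)
  moreover have "{y. cell_sig A y = cell_sig A x} = (\<Inter>p\<in>A. C p)"
    by (auto simp: cell_sig_eq_iff C_def)
  ultimately show ?thesis by simp
qed

lemma polyhedron_union_of_cells:
  assumes "polyhedron P"
  shows "\<exists>A. finite A \<and> union_of_cells A P"
proof -
  from assms obtain F where F: "finite F" "P = \<Inter>F"
    and half: "\<forall>h\<in>F. \<exists>a b. a \<noteq> 0 \<and> h = {x. a \<bullet> x \<le> b}"
    unfolding polyhedron_def by (elim exE conjE)
  have "\<forall>h\<in>F. \<exists>p. h = {x. fst p \<bullet> x \<le> snd p}"
  proof
    fix h assume "h \<in> F"
    with half obtain a b where "h = {x. a \<bullet> x \<le> b}" by blast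
    then have "h = {x. fst (a, b) \<bullet> x \<le> snd (a, b)}" by simp
    then show "\<exists>p. h = {x. fst p \<bullet> x \<le> snd p}" by (rule exI)
  qed
  from bchoice[OF this] obtain p where p: "\<forall>h\<in>F. h = {x. fst (p h) \<bullet> x \<le> snd (p h)}" ..
  have P: "x \<in> P \<longleftrightarrow> (\<forall>r\<in>p ` F. fst r \<bullet> x \<le> snd r)" for x
    unfolding F(2) using p by auto
  have "union_of_cells (p ` F) P"
    unfolding union_of_cells_def cell_sig_eq_iff P le_less by blast
  then show ?thesis using F(1) by blast
qed

lemma polyhedra_union_of_cells:
  assumes "finite \<P>" "\<And>P. P \<in> \<P> \<Longrightarrow> polyhedron P"
  shows "\<exists>A. finite A \<and> (\<forall>P\<in>\<P>. union_of_cells A P)"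
proof -
  have "\<forall>P\<in>\<P>. \<exists>A. finite A \<and> union_of_cells A P"
    using polyhedron_union_of_cells assms(2) by blast
  from bchoice[OF this] obtain A where A: "\<forall>P\<in>\<P>. finite (A P) \<and> union_of_cells (A P) P" ..
  have "union_of_cells (\<Union>(A ` \<P>)) P" if "P \<in> \<P>" for P
    by (rule union_of_cells_mono[of "A P"]) (use A that in auto)
  moreover have "finite (\<Union>(A ` \<P>))" using A assms(1) by blast
  ultimately show ?thesis by blast
qed

lemma eventually_in_union_of_cells:
  assumes "finite A" "union_of_cells A X" "x \<in> X" "v \<in> cell_dirs A x"
  shows "\<forall>\<^sub>F t in at_right 0. x + t *\<^sub>R v \<in> X"
proof -
  have "\<forall>\<^sub>F t in at_right 0. cell_sig A (x + t *\<^sub>R v) = cell_sig A x"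
    using cell_sig_along_direction[OF assms(1,4)] filter_leD[OF at_within_le_nhds] by blast
  then show ?thesis
    by (rule eventually_mono) (metis assms(2,3) union_of_cells_def)
qed

text \<open>
  Two stationary points in one cell that are touched by the same quadratic majorant have equal
  values. The cell allows motion along the connecting line in both directions, so the slope of the
  majorant vanishes at both points, and the increment of a quadratic is the mean of the end slopes.
\<close>
lemma stationary_values_eq_on_cell:
  assumes A: "finite A" "union_of_cells A X" and xy: "cell_sig A x = cell_sig A y"
    and stat: "x \<in> d_stationary \<psi> X" "y \<in> d_stationary \<psi> X" and q: "quadratic_fun q"
    and x: "\<psi> x = q x" "\<forall>\<^sub>F z in nhds x. cell_sig A z = cell_sig A x \<longrightarrow> \<psi> z \<le> q z"
    and y: "\<psi> y = q y" "\<forall>\<^sub>F z in nhds y. cell_sig A z = cell_sig A y \<longrightarrow> \<psi> z \<le> q z"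
  shows "\<psi> x = \<psi> y"
proof -
  have nonneg: "0 \<le> slope q z v"
    if z: "z \<in> d_stationary \<psi> X" "\<psi> z = q z"
      "\<forall>\<^sub>F w in nhds z. cell_sig A w = cell_sig A z \<longrightarrow> \<psi> w \<le> q w" and v: "v \<in> cell_dirs A z" for z v
  proof -
    have "z \<in> X" using z(1) by (simp add: d_stationary_def)
    have "filterlim (\<lambda>t. z + t *\<^sub>R v) (nhds (z + 0 *\<^sub>R v)) (at_right 0)" by (intro tendsto_intros)
    then have "\<forall>\<^sub>F t in at_right 0. cell_sig A (z + t *\<^sub>R v) = cell_sig A z \<longrightarrow> \<psi> (z + t *\<^sub>R v) \<le> q (z + t *\<^sub>R v)"
      using eventually_compose_filterlim[OF z(3)] by simp
    moreover have "\<forall>\<^sub>F t in at_right 0. cell_sig A (z + t *\<^sub>R v) = cell_sig A z"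
      using cell_sig_along_direction[OF A(1) v] filter_leD[OF at_within_le_nhds] by blast
    ultimately have "\<forall>\<^sub>F t in at_right 0. \<exists>i\<in>{()}. \<psi> (z + t *\<^sub>R v) \<le> q (z + t *\<^sub>R v)"
      by eventually_elim simp
    from stationary_active_slope[OF z(1) eventually_in_union_of_cells[OF A \<open>z \<in> X\<close> v] _ _ _ this]
    show ?thesis using q z(2) by simp
  qed
  have zero: "slope q z v = 0"
    if "z \<in> d_stationary \<psi> X" "\<psi> z = q z"
      "\<forall>\<^sub>F w in nhds z. cell_sig A w = cell_sig A z \<longrightarrow> \<psi> w \<le> q w" "v \<in> cell_dirs A z" for z v
    using nonneg[OF that] nonneg[OF that(1-3) subspace_neg[OF subspace_cell_dirs that(4)]]
    by (simp add: slope_minus)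
  have "slope q x (y - x) = 0"
    by (rule zero[OF stat(1) x diff_in_cell_dirs[OF xy]])
  moreover have "slope q y (y - x) = 0"
    using diff_in_cell_dirs[OF xy] cell_dirs_cong[OF xy] by (intro zero[OF stat(2) y]) simp
  ultimately have "q y - q x = 0" using quadratic_fun_increment[OF q, of y x] by simp
  then show ?thesis using x y by simp
qed

text \<open>
  All finiteness proofs below classify stationary points by finitely many combinatorial data (cell,
  active pieces) and then count values within one class.
\<close>
lemma finite_values_by_signature:
  assumes "finite (s ` D)" and "\<And>z. z \<in> D \<Longrightarrow> finite (f ` {x \<in> D. s x = s z})"
  shows "finite (f ` D)"
proof -
  have "f ` D = (\<Union>c\<in>s ` D. f ` {x \<in> D. s x = c})" by auto
  moreover have "finite (\<Union>c\<in>s ` D. f ` {x \<in> D. s x = c})"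
    using assms by (intro finite_UN_I) auto
  ultimately show ?thesis by simp
qed

lemma finite_values_determined_by_signature:
  assumes "finite (s ` D)" and "\<And>x y. x \<in> D \<Longrightarrow> y \<in> D \<Longrightarrow> s x = s y \<Longrightarrow> f x = f y"
  shows "finite (f ` D)"
proof (rule finite_values_by_signature[OF assms(1)])
  fix z assume "z \<in> D"
  then have "f ` {x \<in> D. s x = s z} \<subseteq> {f z}" using assms(2) by blast
  then show "finite (f ` {x \<in> D. s x = s z})" by (rule finite_subset) simp
qed

lemma finite_pair_image:
  assumes "finite (f ` S)" "finite (g ` S)"
  shows "finite ((\<lambda>x. (f x, g x)) ` S)"
  by (rule finite_subset[of _ "f ` S \<times> g ` S"]) (use assms in auto)

section \<open>Piecewise linear-quadratic functions\<close>

lemma plq_on_superset_uminus: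
  assumes "plq_on_superset X \<psi>"
  shows "plq_on_superset X (\<lambda>x. - \<psi> x)"
proof -
  from assms obtain D \<P> where D: "X \<subseteq> D" "continuous_on D \<psi>" "finite \<P>" "D = \<Union>\<P>"
    and \<P>: "\<forall>P\<in>\<P>. polyhedron P \<and> (\<exists>q. quadratic_fun q \<and> (\<forall>x\<in>P. \<psi> x = q x))"
    unfolding plq_on_superset_def piecewise_linear_quadratic_on_def by blast
  have "polyhedron P \<and> (\<exists>q. quadratic_fun q \<and> (\<forall>x\<in>P. - \<psi> x = q x))" if "P \<in> \<P>" for P
  proof -
    from \<P> that obtain q where "polyhedron P" "quadratic_fun q" "\<forall>x\<in>P. \<psi> x = q x" by blast
    then show ?thesis using quadratic_fun_uminus[of q] by (intro conjI exI[of _ "\<lambda>x. - q x"]) auto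
  qed
  then show ?thesis
    unfolding plq_on_superset_def piecewise_linear_quadratic_on_def
    using D by (intro exI[of _ D] exI[of _ \<P>] conjI) (auto intro: continuous_on_minus)
qed

lemma plq_on_superset_selection:
  assumes "plq_on_superset X \<psi>"
  shows "quadratic_selection_on X \<psi>"
proof -
  from assms obtain D \<P> where D: "X \<subseteq> D" "continuous_on D \<psi>" "finite \<P>" "D = \<Union>\<P>"
    and \<P>: "\<forall>P\<in>\<P>. polyhedron P \<and> (\<exists>q. quadratic_fun q \<and> (\<forall>x\<in>P. \<psi> x = q x))"
    unfolding plq_on_superset_def piecewise_linear_quadratic_on_def by blast
  from \<P> have "\<forall>P\<in>\<P>. \<exists>q. quadratic_fun q \<and> (\<forall>x\<in>P. \<psi> x = q x)" by blast
  from bchoice[OF this] obtain q where q: "\<forall>P\<in>\<P>. quadratic_fun (q P) \<and> (\<forall>x\<in>P. \<psi> x = q P x)" ..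
  have "\<exists>h\<in>q ` \<P>. \<psi> x = h x" if "x \<in> X" for x using D(1,4) q that by blast
  then show ?thesis
    unfolding quadratic_selection_on_def
    using D q continuous_on_subset by (intro conjI exI[of _ "q ` \<P>"]) auto
qed

text \<open>
  The cells of an arrangement containing all bounding hyperplanes of X and of the pieces refine the
  pieces, so within a cell the function is its own quadratic majorant.
\<close>
lemma finite_stationary_values_plq:
  assumes "polyhedron X" "plq_on_superset X \<psi>"
  shows "finite (\<psi> ` d_stationary \<psi> X)"
proof -
  from assms(2) obtain D \<P> where D: "X \<subseteq> D" "finite \<P>" "D = \<Union>\<P>"
    and \<P>: "\<forall>P\<in>\<P>. polyhedron P \<and> (\<exists>q. quadratic_fun q \<and> (\<forall>x\<in>P. \<psi> x = q x))"
    unfolding plq_on_superset_def piecewise_linear_quadratic_on_def by blast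
  have "\<exists>A. finite A \<and> (\<forall>P\<in>insert X \<P>. union_of_cells A P)"
    using D(2) \<P> assms(1) by (intro polyhedra_union_of_cells) auto
  then obtain A where A: "finite A" "\<forall>P\<in>insert X \<P>. union_of_cells A P" by blast
  show ?thesis
  proof (rule finite_values_determined_by_signature[OF finite_cell_sigs[OF A(1)]])
    fix x y assume xy: "x \<in> d_stationary \<psi> X" "y \<in> d_stationary \<psi> X" "cell_sig A x = cell_sig A y"
    then have "x \<in> X" by (simp add: d_stationary_def)
    then obtain P where P: "P \<in> \<P>" "x \<in> P" using D(1,3) by blast
    then obtain q where q: "quadratic_fun q" "\<forall>x\<in>P. \<psi> x = q x" using \<P> by blast
    have "union_of_cells A P" using A(2) P(1) by blast
    then have cell: "\<psi> z = q z" if "cell_sig A z = cell_sig A x" for z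
      using P(2) q(2) that[symmetric] unfolding union_of_cells_def by blast
    show "\<psi> x = \<psi> y"
      using A(2) cell xy(3)
      by (intro stationary_values_eq_on_cell[OF A(1) _ xy(3,1,2) q(1)] always_eventually) simp_all
  qed
qed

section \<open>Maxima of convex and of concave quadratic functions\<close>

text \<open>
  In the arrangement of the hyperplanes \<open>h = h'\<close>, two pieces agree everywhere or nowhere on a cell.
  As cells are connected, the function is a single affine piece on each of them.
\<close>
lemma piecewise_affine_on_cells:
  fixes g :: "real ^ 'n \<Rightarrow> real"
  assumes "piecewise_affine g"
  shows "\<exists>A. finite A \<and> (\<forall>x. \<exists>h. affine_fun h \<and> (\<forall>z. cell_sig A z = cell_sig A x \<longrightarrow> g z = h z))"
proof -
  from assms obtain H where g: "continuous_on UNIV g"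
    and H: "finite H" "\<forall>h\<in>H. affine_fun h" "\<forall>x. \<exists>h\<in>H. g x = h x"
    unfolding piecewise_affine_def by blast
  have "\<forall>h\<in>H. \<exists>p. \<forall>x. h x = fst p \<bullet> x + snd p"
  proof
    fix h assume "h \<in> H"
    with H(2) obtain c d where "\<forall>x. h x = c \<bullet> x + d" unfolding affine_fun_def by blast
    then show "\<exists>p. \<forall>x. h x = fst p \<bullet> x + snd p" by (intro exI[of _ "(c, d)"]) simp
  qed
  from bchoice[OF this] obtain p where p: "\<forall>h\<in>H. \<forall>x. h x = fst (p h) \<bullet> x + snd (p h)" ..
  define A where "A = (\<lambda>(h, h'). (fst (p h) - fst (p h'), snd (p h') - snd (p h))) ` (H \<times> H)"
  have eq: "h z = h' z \<longleftrightarrow> h x = h' x" if "h \<in> H" "h' \<in> H" "cell_sig A z = cell_sig A x" for h h' z x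
  proof -
    have "(fst (p h) - fst (p h'), snd (p h') - snd (p h)) \<in> A" using that(1,2) by (auto simp: A_def)
    from bspec[OF that(3)[unfolded cell_sig_eq_iff] this]
    have "(fst (p h) - fst (p h')) \<bullet> z = snd (p h') - snd (p h) \<longleftrightarrow>
        (fst (p h) - fst (p h')) \<bullet> x = snd (p h') - snd (p h)" by simp
    moreover have "h w = fst (p h) \<bullet> w + snd (p h)" "h' w = fst (p h') \<bullet> w + snd (p h')" for w
      using p that(1,2) by blast+
    ultimately show ?thesis by (simp only: inner_diff_left) linarith
  qed
  have "\<exists>h. affine_fun h \<and> (\<forall>z. cell_sig A z = cell_sig A x \<longrightarrow> g z = h z)" for x
  proof -
    define S where "S = {z. cell_sig A z = cell_sig A x}"
    have "\<exists>h\<in>H. \<forall>z\<in>S. g z = h z"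
    proof (rule connected_selection)
      show "connected S" unfolding S_def by (intro convex_connected convex_cell)
      show "S \<noteq> {}" by (auto simp: S_def)
      show "continuous_on S g" using g continuous_on_subset by blast
      show "\<And>h. h \<in> H \<Longrightarrow> continuous_on S h"
        using H(2) by (intro quadratic_fun_continuous affine_fun_quadratic) blast
      show "\<And>z. z \<in> S \<Longrightarrow> \<exists>h\<in>H. g z = h z" using H(3) by blast
      show "(\<forall>z\<in>S. h z = h' z) \<or> (\<forall>z\<in>S. h z \<noteq> h' z)" if "h \<in> H" "h' \<in> H" for h h'
      proof (cases "h x = h' x")
        case True
        then have "h z = h' z" if "z \<in> S" for z
          using eq[OF \<open>h \<in> H\<close> \<open>h' \<in> H\<close>, of z x] that unfolding S_def by blast
        then show ?thesis by blast
      next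
        case False
        then have "h z \<noteq> h' z" if "z \<in> S" for z
          using eq[OF \<open>h \<in> H\<close> \<open>h' \<in> H\<close>, of z x] that unfolding S_def by blast
        then show ?thesis by blast
      qed
    qed (rule H(1))
    then obtain h where "h \<in> H" "\<forall>z\<in>S. g z = h z" by blast
    then show ?thesis using H(2) unfolding S_def by blast
  qed
  moreover have "finite A" using H(1) by (simp add: A_def)
  ultimately show ?thesis by blast
qed

lemma piecewise_affine_selection:
  assumes "piecewise_affine g"
  shows "quadratic_selection_on X g"
  using assms unfolding piecewise_affine_def quadratic_selection_on_def
  by (meson UNIV_I affine_fun_quadratic continuous_on_subset subset_UNIV)

text \<open>
  On each cell the function is convex, so a stationary point minimizes it over the cell.
\<close>
lemma finite_stationary_values_affine_plus_max:
  assumes g: "piecewise_affine g" and I: "finite I" "I \<noteq> {}" "\<And>i. i \<in> I \<Longrightarrow> convex_on UNIV (f i)"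
  defines "\<psi> \<equiv> \<lambda>x. g x + Max ((\<lambda>i. f i x) ` I)"
  shows "finite (\<psi> ` d_stationary \<psi> X)"
proof -
  obtain A where A: "finite A"
    "\<forall>x. \<exists>h. affine_fun h \<and> (\<forall>z. cell_sig A z = cell_sig A x \<longrightarrow> g z = h z)"
    using piecewise_affine_on_cells[OF g] by blast
  show ?thesis
  proof (rule finite_values_determined_by_signature[OF finite_cell_sigs[OF A(1)]])
    fix x y assume xy: "x \<in> d_stationary \<psi> X" "y \<in> d_stationary \<psi> X" "cell_sig A x = cell_sig A y"
    define C where "C = {z. cell_sig A z = cell_sig A x}"
    obtain h where h: "affine_fun h" "\<forall>z. cell_sig A z = cell_sig A x \<longrightarrow> g z = h z" using A(2) by blast
    define p where "p = (\<lambda>x. h x + Max ((\<lambda>i. f i x) ` I))"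
    have "convex_on UNIV p"
      unfolding p_def by (intro convex_on_add affine_fun_convex h(1) convex_on_Max I) auto
    moreover have "convex C" unfolding C_def by (rule convex_cell)
    ultimately have p: "convex_on C p" using convex_on_subset subset_UNIV by blast
    have eq: "\<psi> z = p z" if "z \<in> C" for z using h(2) that by (auto simp: \<psi>_def p_def C_def)
    have C: "x \<in> C" "y \<in> C" using xy(3) by (auto simp: C_def)
    have X: "x \<in> X" "y \<in> X" using xy(1,2) by (auto simp: d_stationary_def)
    have "p x \<le> p y"
      by (rule stationary_convex_majorant[OF xy(1) X(2) p C]) (auto simp: eq C)
    moreover have "p y \<le> p x"
      by (rule stationary_convex_majorant[OF xy(2) X(1) p C(2,1)]) (auto simp: eq C)
    ultimately show "\<psi> x = \<psi> y" using eq C by simp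
  qed
qed

text \<open>
  With i active at x, the function \<open>- (h + f i)\<close> is a quadratic majorant that touches at x, where h
  is the affine piece of g on the cell of x.
\<close>
lemma finite_stationary_values_minus_affine_plus_max:
  assumes X: "polyhedron X" and g: "piecewise_affine g"
    and I: "finite I" "I \<noteq> {}" "\<And>i. i \<in> I \<Longrightarrow> quadratic_fun (f i)"
  defines "\<psi> \<equiv> \<lambda>x. - (g x + Max ((\<lambda>i. f i x) ` I))"
  shows "finite (\<psi> ` d_stationary \<psi> X)"
proof -
  obtain A1 where A1: "finite A1"
    "\<forall>x. \<exists>h. affine_fun h \<and> (\<forall>z. cell_sig A1 z = cell_sig A1 x \<longrightarrow> g z = h z)"
    using piecewise_affine_on_cells[OF g] by blast
  obtain A2 where A2: "finite A2" "union_of_cells A2 X" using polyhedron_union_of_cells[OF X] by blast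
  define A where "A = A1 \<union> A2"
  have A: "finite A" "union_of_cells A X"
    using A1(1) A2 union_of_cells_mono[OF A2(2)] by (auto simp: A_def)
  obtain m where m: "\<forall>x. m x \<in> I \<and> f (m x) x = Max ((\<lambda>i. f i x) ` I)"
    using Max_image_attained[OF I(1,2)] by (rule exE)
  have "finite ((\<lambda>x. (cell_sig A x, m x)) ` d_stationary \<psi> X)"
    by (intro finite_pair_image finite_cell_sigs A finite_subset[OF _ I(1)]) (use m in auto)
  then show ?thesis
  proof (rule finite_values_determined_by_signature)
    fix x y assume xy: "x \<in> d_stationary \<psi> X" "y \<in> d_stationary \<psi> X"
      "(cell_sig A x, m x) = (cell_sig A y, m y)"
    then have cell: "cell_sig A x = cell_sig A y" and myx: "m y = m x" by auto
    obtain h where h: "affine_fun h" "\<forall>z. cell_sig A1 z = cell_sig A1 x \<longrightarrow> g z = h z" using A1(2) by blast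
    have gh: "g z = h z" if "cell_sig A z = cell_sig A x" for z
      using h(2) cell_sig_mono[OF that, of A1] by (auto simp: A_def)
    define q where "q = (\<lambda>z. - (h z + f (m x) z))"
    have "quadratic_fun (f (m x))" using m I(3) by blast
    then have q: "quadratic_fun q"
      unfolding q_def by (intro quadratic_fun_uminus quadratic_fun_add affine_fun_quadratic[OF h(1)])
    have le: "\<psi> z \<le> q z" if "cell_sig A z = cell_sig A x" for z
    proof -
      have "f (m x) z \<le> Max ((\<lambda>i. f i z) ` I)" using m I(1) by (intro Max_ge) auto
      then show ?thesis using gh[OF that] by (simp add: \<psi>_def q_def)
    qed
    have "f (m x) x = Max ((\<lambda>i. f i x) ` I)" "f (m x) y = Max ((\<lambda>i. f i y) ` I)"
      using m myx by metis+
    then have "\<psi> x = q x" "\<psi> y = q y"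
      using gh[of x] gh[of y] cell by (simp_all add: \<psi>_def q_def)
    then show "\<psi> x = \<psi> y"
      using le cell
      by (intro stationary_values_eq_on_cell[OF A cell xy(1,2) q] always_eventually) auto
  qed
qed

lemma strictly_convex_on_imp_convex_on:
  assumes "strictly_convex_on S f"
  shows "convex_on S f"
proof (rule convex_onI)
  fix t x y assume t: "0 < t" "t < (1::real)" and xy: "x \<in> S" "y \<in> S"
  show "f ((1 - t) *\<^sub>R x + t *\<^sub>R y) \<le> (1 - t) * f x + t * f y"
  proof (cases "x = y")
    case True
    then have "(1 - t) *\<^sub>R x + t *\<^sub>R y = x" by (simp add: algebra_simps)
    then show ?thesis using True by (simp add: algebra_simps)
  next
    case False
    have "\<forall>u>0. \<forall>v>0. x \<noteq> y \<longrightarrow> u + v = 1 \<longrightarrow> f (u *\<^sub>R x + v *\<^sub>R y) < u * f x + v * f y"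
      using assms xy unfolding strictly_convex_on_def by blast
    from this[rule_format, of "1 - t" t] show ?thesis using False t by simp
  qed
next
  show "convex S" using assms by (simp add: strictly_convex_on_def)
qed

text \<open>
  The midpoint inequality at y, rewritten: a central difference bounds the increment of a concave
  function.
\<close>
lemma concave_slope_bound:
  assumes "concave_on UNIV p"
  shows "p (y + v) \<le> p y + slope p y v"
proof -
  have "- p ((1 - 1 / 2) *\<^sub>R (y + v) + (1 / 2) *\<^sub>R (y - v)) \<le> (1 - 1 / 2) * (- p (y + v)) + (1 / 2) * (- p (y - v))"
    by (rule convex_onD[OF assms[unfolded concave_on_def]]) auto
  moreover have "(1 - 1 / 2) *\<^sub>R (y + v) + (1 / 2) *\<^sub>R (y - v) = y"
    by (simp add: algebra_simps flip: scaleR_left_distrib)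
  ultimately show ?thesis by (simp add: slope_def field_simps)
qed

text \<open>
  Fix a cell, the set of active concave pieces and one active convex piece. Moving from y in the
  direction away from x, some active difference p i of a concave and a convex piece has nonnegative
  slope at y; being concave, it satisfies \<open>p i x \<le> p i y\<close>. Since i is also active at x, this compares
  the values of \<open>\<psi>\<close>, and exchanging x and y gives equality.
\<close>
lemma finite_stationary_values_max_concave_minus_max_convex:
  assumes X: "polyhedron X"
    and I: "finite I" "I \<noteq> {}" "\<And>i. i \<in> I \<Longrightarrow> quadratic_fun (f i)" "\<And>i. i \<in> I \<Longrightarrow> concave_on UNIV (f i)"
    and J: "finite J" "J \<noteq> {}" "\<And>j. j \<in> J \<Longrightarrow> quadratic_fun (g j)" "\<And>j. j \<in> J \<Longrightarrow> convex_on UNIV (g j)"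
  defines "\<psi> \<equiv> \<lambda>x. Max ((\<lambda>i. f i x) ` I) - Max ((\<lambda>j. g j x) ` J)"
  shows "finite (\<psi> ` d_stationary \<psi> X)"
proof -
  obtain A where A: "finite A" "union_of_cells A X" using polyhedron_union_of_cells[OF X] by blast
  obtain n where n: "\<forall>x. n x \<in> J \<and> g (n x) x = Max ((\<lambda>j. g j x) ` J)"
    using Max_image_attained[OF J(1,2)] by (rule exE)
  obtain m where m: "\<forall>x. m x \<in> I \<and> f (m x) x = Max ((\<lambda>i. f i x) ` I)"
    using Max_image_attained[OF I(1,2)] by (rule exE)
  define act where "act = (\<lambda>x. {i \<in> I. f i x = Max ((\<lambda>i. f i x) ` I)})"
  have le: "\<psi> x \<le> \<psi> y"
    if x: "x \<in> X" and y: "y \<in> d_stationary \<psi> X"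
      and same: "cell_sig A x = cell_sig A y" "act x = act y" "n x = n y" for x y
  proof -
    define p where "p = (\<lambda>i z. f i z - g (n y) z)"
    have nJ: "n y \<in> J" using n by blast
    have quad: "quadratic_fun (p i)" if "i \<in> I" for i
      unfolding p_def by (intro quadratic_fun_diff I(3) J(3) that nJ)
    have fM: "f i z \<le> Max ((\<lambda>i. f i z) ` I)" if "i \<in> I" for i z
      using that I(1) by (intro Max_ge) auto
    have \<psi>y: "\<psi> y = Max ((\<lambda>i. f i y) ` I) - g (n y) y" using n by (simp add: \<psi>_def)
    have dir: "y - x \<in> cell_dirs A y"
      using diff_in_cell_dirs[OF same(1)] cell_dirs_cong[OF same(1)] by simp
    have yX: "y \<in> X" using y by (simp add: d_stationary_def)
    have major: "\<exists>i\<in>I. \<psi> z \<le> p i z" for z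
    proof -
      have "g (n y) z \<le> Max ((\<lambda>j. g j z) ` J)" using nJ J(1) by (intro Max_ge) auto
      moreover have "f (m z) z = Max ((\<lambda>i. f i z) ` I)" using m by blast
      ultimately have "\<psi> z \<le> p (m z) z" by (simp add: \<psi>_def p_def)
      then show ?thesis using m by blast
    qed
    have "\<exists>i\<in>I. p i y = \<psi> y \<and> 0 \<le> slope (p i) y (y - x)"
    proof (rule stationary_active_slope[OF y eventually_in_union_of_cells[OF A yX dir] I(1) quad])
      show "p i y \<le> \<psi> y" if "i \<in> I" for i using fM[OF that, of y] by (simp add: p_def \<psi>y)
      show "\<forall>\<^sub>F t in at_right 0. \<exists>i\<in>I. \<psi> (y + t *\<^sub>R (y - x)) \<le> p i (y + t *\<^sub>R (y - x))"
        using major by (intro always_eventually) blast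
    qed
    then obtain i where i: "i \<in> I" "p i y = \<psi> y" "0 \<le> slope (p i) y (y - x)" by blast
    have "i \<in> act y" using i(1,2) by (simp add: act_def p_def \<psi>y)
    then have "i \<in> act x" using same(2) by simp
    moreover have "g (n y) x = Max ((\<lambda>j. g j x) ` J)" using n same(3) by metis
    ultimately have "\<psi> x = p i x" by (simp add: act_def \<psi>_def p_def)
    also have "p i x \<le> p i y + slope (p i) y (x - y)"
    proof -
      have "concave_on UNIV (p i)"
        using convex_on_add[OF I(4)[OF i(1), unfolded concave_on_def] J(4)[OF nJ]]
        by (simp add: concave_on_def p_def algebra_simps)
      from concave_slope_bound[OF this, of y "x - y"] show ?thesis by simp
    qed
    also have "slope (p i) y (x - y) = - slope (p i) y (y - x)"
      using slope_minus[of "p i" y "y - x"] by simp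
    finally show ?thesis using i(2,3) by simp
  qed
  have "finite ((\<lambda>x. (cell_sig A x, act x, n x)) ` d_stationary \<psi> X)"
  proof (intro finite_pair_image finite_cell_sigs A(1))
    show "finite (act ` d_stationary \<psi> X)"
      by (rule finite_subset[of _ "Pow I"]) (use I(1) in \<open>auto simp: act_def\<close>)
    show "finite (n ` d_stationary \<psi> X)"
      by (rule finite_subset[OF _ J(1)]) (use n in auto)
  qed
  then show ?thesis
  proof (rule finite_values_determined_by_signature)
    fix x y assume xy: "x \<in> d_stationary \<psi> X" "y \<in> d_stationary \<psi> X"
      "(cell_sig A x, act x, n x) = (cell_sig A y, act y, n y)"
    then have "x \<in> X" "y \<in> X" by (auto simp: d_stationary_def)
    then show "\<psi> x = \<psi> y" using le[of x y] le[of y x] xy by auto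
  qed
qed

text \<open>
  Replacing the subtracted maximum by one active concave piece gives a convex majorant that touches,
  so x minimizes that majorant over X.
\<close>
lemma finite_stationary_values_max_convex_minus_max_concave:
  assumes I: "finite I" "I \<noteq> {}" "\<And>i. i \<in> I \<Longrightarrow> concave_on UNIV (f i)"
    and J: "finite J" "J \<noteq> {}" "\<And>j. j \<in> J \<Longrightarrow> convex_on UNIV (g j)"
  defines "\<psi> \<equiv> \<lambda>x. Max ((\<lambda>j. g j x) ` J) - Max ((\<lambda>i. f i x) ` I)"
  shows "finite (\<psi> ` d_stationary \<psi> X)"
proof -
  obtain m where m: "\<forall>x. m x \<in> I \<and> f (m x) x = Max ((\<lambda>i. f i x) ` I)"
    using Max_image_attained[OF I(1,2)] by (rule exE)
  have le: "\<psi> x \<le> \<psi> y" if x: "x \<in> d_stationary \<psi> X" and y: "y \<in> X" and same: "m x = m y" for x y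
  proof -
    define p where "p = (\<lambda>z. Max ((\<lambda>j. g j z) ` J) - f (m x) z)"
    have "convex_on UNIV (\<lambda>z. Max ((\<lambda>j. g j z) ` J) + - f (m x) z)"
      using m I(3) unfolding concave_on_def by (intro convex_on_add convex_on_Max J) auto
    then have "convex_on UNIV p" by (simp add: p_def)
    moreover have "\<psi> z \<le> p z" for z
      using m I(1) by (auto simp: \<psi>_def p_def intro!: Max_ge)
    moreover have "\<psi> x = p x" using m by (simp add: \<psi>_def p_def)
    ultimately have "p x \<le> p y"
      using x y by (intro stationary_convex_majorant[of x \<psi> X y UNIV p]) auto
    moreover have "\<psi> y = p y" using m same by (simp add: \<psi>_def p_def)
    ultimately show ?thesis using \<open>\<psi> x = p x\<close> by simp
  qed
  have "finite (m ` d_stationary \<psi> X)" by (rule finite_subset[OF _ I(1)]) (use m in auto)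
  then show ?thesis
  proof (rule finite_values_determined_by_signature)
    fix x y assume xy: "x \<in> d_stationary \<psi> X" "y \<in> d_stationary \<psi> X" "m x = m y"
    then have "x \<in> X" "y \<in> X" by (auto simp: d_stationary_def)
    then show "\<psi> x = \<psi> y" using le[of x y] le[of y x] xy by auto
  qed
qed

section \<open>Generalized inverses over an integral domain\<close>

lemma fract_common_denominator:
  fixes S :: "'a::idom fract set"
  assumes "finite S"
  shows "\<exists>D. D \<noteq> 0 \<and> (\<forall>x\<in>S. \<exists>a. to_fract D * x = to_fract a)"
  using assms
proof (induction S)
  case empty
  show ?case by (rule exI[of _ 1]) auto
next
  case (insert x S)
  then obtain D where D: "D \<noteq> 0" "\<forall>y\<in>S. \<exists>a. to_fract D * y = to_fract a" by blast
  obtain a b where x: "x = Fract a b" "b \<noteq> 0" by (rule Fract_cases)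
  have "to_fract (b * D) * x = to_fract (D * a)"
    using x by (simp add: to_fract_def eq_fract)
  moreover have "\<exists>c. to_fract (b * D) * y = to_fract c" if "y \<in> S" for y
  proof -
    from bspec[OF D(2) that] obtain c where c: "to_fract D * y = to_fract c" ..
    have "to_fract (b * D) * y = to_fract b * (to_fract D * y)" by (simp only: to_fract_mult mult.assoc)
    also have "\<dots> = to_fract (b * c)" by (simp only: c to_fract_mult)
    finally have "to_fract (b * D) * y = to_fract (b * c)" .
    then show ?thesis by blast
  qed
  moreover have "b * D \<noteq> 0" using x D by simp
  ultimately show ?case by blast
qed

lemma to_fract_sum: "to_fract (sum f S) = (\<Sum>x\<in>S. to_fract (f x))"
  by (induction S rule: infinite_finite_induct) auto

text \<open>
  G sends each vector in the range of A to one of its preimages.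
\<close>
lemma field_generalized_inverse:
  fixes A :: "'a::field ^ 'n ^ 'n"
  shows "\<exists>G :: 'a ^ 'n ^ 'n. A ** G ** A = A"
proof -
  have "Vector_Spaces.linear (*s) (*s) ((*v) A)" by (rule matrix_vector_mul_linear_gen)
  from vec.linear_exists_right_inverse_on[OF this vec.subspace_UNIV]
  obtain g where lin: "Vector_Spaces.linear (*s) (*s) g"
    and g: "\<forall>x\<in>range ((*v) A). A *v g x = x" by blast
  have "(A ** matrix g ** A) *v x = A *v x" for x
  proof -
    have "(A ** matrix g ** A) *v x = A *v (matrix g *v (A *v x))"
      by (simp only: matrix_vector_mul_assoc matrix_mul_assoc)
    also have "\<dots> = A *v g (A *v x)"
      by (simp only: matrix_works[OF lin])
    also have "\<dots> = A *v x" using g by blast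
    finally show ?thesis .
  qed
  then have "A ** matrix g ** A = A"
    unfolding matrix_eq by blast
  then show ?thesis by blast
qed

text \<open>
  A generalized inverse over the field of fractions, multiplied by a common denominator. For
  matrices with polynomial entries it describes the solutions of a linear system uniformly in the
  parameter, without distinguishing ranks.
\<close>
lemma idom_generalized_inverse:
  fixes A :: "'a::idom ^ 'n ^ 'n"
  shows "\<exists>(G :: 'a ^ 'n ^ 'n) D. D \<noteq> 0 \<and> (\<forall>i j. (A ** G ** A) $ i $ j = D * A $ i $ j)"
proof -
  define A' where "A' = (\<chi> i j. to_fract (A $ i $ j))"
  obtain G' where G': "A' ** G' ** A' = A'" using field_generalized_inverse by blast
  have "finite (range (\<lambda>(i, j). G' $ i $ j))" by simp
  from fract_common_denominator[OF this] obtain D where D: "D \<noteq> 0"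
    "\<forall>x\<in>range (\<lambda>(i, j). G' $ i $ j). \<exists>a. to_fract D * x = to_fract a" by blast
  have "\<exists>a. to_fract D * G' $ i $ j = to_fract a" for i j
    by (rule D(2)[rule_format]) (rule range_eqI[of _ _ "(i, j)"], simp)
  then obtain g where g: "\<And>i j. to_fract D * G' $ i $ j = to_fract (g i j)" by metis
  define G where "G = (\<chi> i j. g i j)"
  have "(A ** G ** A) $ i $ j = D * A $ i $ j" for i j
  proof -
    have "to_fract ((A ** G ** A) $ i $ j) =
        (\<Sum>k\<in>UNIV. (\<Sum>l\<in>UNIV. A' $ i $ l * (to_fract D * G' $ l $ k)) * A' $ k $ j)"
      by (simp add: matrix_matrix_mult_def to_fract_sum G_def A'_def g)
    also have "\<dots> = to_fract D * (A' ** G' ** A') $ i $ j"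
      by (simp add: matrix_matrix_mult_def sum_distrib_left sum_distrib_right mult_ac)
    also have "\<dots> = to_fract (D * A $ i $ j)"
      unfolding G' by (simp add: A'_def)
    finally show ?thesis by (simp only: to_fract_eq_iff)
  qed
  then have "\<forall>i j. (A ** G ** A) $ i $ j = D * A $ i $ j" by (intro allI)
  with D(1) have "D \<noteq> 0 \<and> (\<forall>i j. (A ** G ** A) $ i $ j = D * A $ i $ j)" by (rule conjI)
  then show ?thesis by (rule exI[of "\<lambda>G. \<exists>D. D \<noteq> 0 \<and> (\<forall>i j. (A ** G ** A) $ i $ j = D * A $ i $ j)", OF exI])
qed

section \<open>Critical values of a quadratic on the zero set of another\<close>

definition polynomial_fun :: "(real \<Rightarrow> real) \<Rightarrow> bool" where
  "polynomial_fun f \<longleftrightarrow> (\<exists>p. \<forall>t. f t = poly p t)"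

lemma polynomial_fun_const [intro]: "polynomial_fun (\<lambda>t. a)"
  unfolding polynomial_fun_def by (rule exI[of _ "[:a:]"]) simp

lemma polynomial_fun_ident [intro]: "polynomial_fun (\<lambda>t. t)"
  unfolding polynomial_fun_def by (rule exI[of _ "[:0, 1:]"]) simp

lemma polynomial_fun_poly [intro]: "polynomial_fun (poly p)"
  unfolding polynomial_fun_def by blast

lemma polynomial_fun_add [intro]:
  "polynomial_fun f \<Longrightarrow> polynomial_fun g \<Longrightarrow> polynomial_fun (\<lambda>t. f t + g t)"
  unfolding polynomial_fun_def by (metis poly_add)

lemma polynomial_fun_diff [intro]:
  "polynomial_fun f \<Longrightarrow> polynomial_fun g \<Longrightarrow> polynomial_fun (\<lambda>t. f t - g t)"
  unfolding polynomial_fun_def by (metis poly_diff)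

lemma polynomial_fun_mult [intro]:
  "polynomial_fun f \<Longrightarrow> polynomial_fun g \<Longrightarrow> polynomial_fun (\<lambda>t. f t * g t)"
  unfolding polynomial_fun_def by (metis poly_mult)

lemma polynomial_fun_sum [intro]:
  "(\<And>i. i \<in> S \<Longrightarrow> polynomial_fun (f i)) \<Longrightarrow> polynomial_fun (\<lambda>t. \<Sum>i\<in>S. f i t)"
  by (induction S rule: infinite_finite_induct) (auto intro: polynomial_fun_const polynomial_fun_add)

lemma polynomial_fun_eqI:
  assumes "polynomial_fun f" "polynomial_fun g" "infinite {t. f t = g t}"
  shows "f t = g t"
proof -
  from assms(1,2) obtain p q where pq: "\<forall>t. f t = poly p t" "\<forall>t. g t = poly q t" unfolding polynomial_fun_def by blast
  have "p - q = 0"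
  proof (rule ccontr)
    assume "p - q \<noteq> 0"
    then have "finite {t. poly (p - q) t = 0}" by (rule poly_roots_finite)
    then show False using assms(3) pq by simp
  qed
  then show ?thesis using pq by simp
qed

text \<open>
  Comparing leading coefficients forces equal degrees; subtracting a multiple of q then lowers the
  degree without changing the identity.
\<close>
lemma wronskian_zero_imp_proportional:
  fixes p q :: "real poly"
  assumes "pderiv p * q = p * pderiv q" and "q \<noteq> 0"
  shows "\<exists>k. p = smult k q"
  using assms(1)
proof (induction "degree p" arbitrary: p rule: less_induct)
  case less
  show ?case
  proof (cases "p = 0")
    case True
    then have "p = smult 0 q" by simp
    then show ?thesis by blast
  next
    case False
    define m n where "m = degree p" and "n = degree q"
    have "degree p = degree q"
    proof -
      have "coeff (pderiv p * q) (m + n - 1) = coeff (p * pderiv q) (m + n - 1)"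
        using less.prems by simp
      moreover have "coeff (pderiv p * q) (m + n - 1) = of_nat m * lead_coeff p * lead_coeff q"
      proof (cases "m = 0")
        case True
        then have "pderiv p = 0" by (simp add: m_def pderiv_eq_0_iff)
        then show ?thesis using True by simp
      next
        case m: False
        have "coeff (pderiv p * q) (degree (pderiv p) + degree q)
            = lead_coeff (pderiv p) * lead_coeff q" by (rule coeff_mult_degree_sum)
        moreover have "degree (pderiv p) + degree q = m + n - 1"
          using m by (simp add: degree_pderiv m_def n_def)
        moreover have "lead_coeff (pderiv p) = of_nat m * lead_coeff p"
          using m by (simp add: degree_pderiv coeff_pderiv m_def)
        ultimately show ?thesis by simp
      qed
      moreover have "coeff (p * pderiv q) (m + n - 1) = of_nat n * lead_coeff p * lead_coeff q"
      proof (cases "n = 0")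
        case True
        then have "pderiv q = 0" by (simp add: n_def pderiv_eq_0_iff)
        then show ?thesis using True by simp
      next
        case n: False
        have "coeff (p * pderiv q) (degree p + degree (pderiv q))
            = lead_coeff p * lead_coeff (pderiv q)" by (rule coeff_mult_degree_sum)
        moreover have "degree p + degree (pderiv q) = m + n - 1"
          using n by (simp add: degree_pderiv m_def n_def)
        moreover have "lead_coeff (pderiv q) = of_nat n * lead_coeff q"
          using n by (simp add: degree_pderiv coeff_pderiv n_def)
        ultimately show ?thesis by simp
      qed
      ultimately show ?thesis using False assms(2) by (simp add: m_def n_def)
    qed
    define k where "k = lead_coeff p / lead_coeff q"
    define p' where "p' = p - smult k q"
    have eq: "pderiv p' * q = p' * pderiv q"
      using less.prems by (simp add: p'_def pderiv_diff pderiv_smult algebra_simps)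
    have "p' = 0 \<or> degree p' < degree p"
    proof (cases "degree p = 0")
      case True
      then obtain a b where "p = [:a:]" "q = [:b:]" using \<open>degree p = degree q\<close> degree_eq_zeroE by metis
      then show ?thesis using assms(2) by (simp add: p'_def k_def)
    next
      case d: False
      have "coeff p' (degree p) = 0"
        using \<open>degree p = degree q\<close> assms(2) by (simp add: p'_def k_def)
      moreover have "degree p' \<le> degree p"
        unfolding p'_def using \<open>degree p = degree q\<close> by (simp add: degree_diff_le)
      ultimately show ?thesis using d
        by (metis eq_zero_or_degree_less)
    qed
    then obtain k' where "p' = smult k' q"
    proof
      assume "p' = 0"
      then have "p' = smult 0 q" by simp
      then show thesis by (rule that)
    next
      assume "degree p' < degree p"
      from less.hyps[OF this eq] show thesis using that by blast
    qed
    then have "p = smult (k + k') q" by (simp add: p'_def smult_add_left algebra_simps)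
    then show ?thesis by blast
  qed
qed

lemma symmetric_inner:
  fixes A :: "real ^ 'n ^ 'n"
  assumes "transpose A = A"
  shows "x \<bullet> (A *v y) = y \<bullet> (A *v x)"
  by (metis assms dot_lmul_matrix inner_commute transpose_matrix_vector)

lemma matrix_mult_add_rdistrib:
  fixes A B :: "'a::semiring_1 ^ 'n ^ 'm"
  shows "(A + B) ** C = A ** C + B ** C"
  by (vector matrix_matrix_mult_def sum.distrib[symmetric] distrib_right)

text \<open>
  For a symmetric matrix the transpose of a generalized inverse is again one, so adding the two makes
  the inverse symmetric at the price of a factor 2 in the denominator.
\<close>
lemma symmetric_pencil_generalized_inverse:
  fixes Q R :: "real ^ 'n ^ 'n"
  assumes "transpose Q = Q" "transpose R = R"
  shows "\<exists>(G :: real \<Rightarrow> real ^ 'n ^ 'n) D.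
           D \<noteq> 0 \<and> (\<forall>t. transpose (G t) = G t) \<and> (\<forall>i j. polynomial_fun (\<lambda>t. G t $ i $ j)) \<and>
           (\<forall>t. (Q + t *\<^sub>R R) ** G t ** (Q + t *\<^sub>R R) = poly D t *\<^sub>R (Q + t *\<^sub>R R))"
proof -
  define A where "A = (\<chi> i j. [:Q $ i $ j, R $ i $ j:])"
  obtain H D where D: "D \<noteq> 0" and H: "\<And>i j. (A ** H ** A) $ i $ j = D * A $ i $ j"
    using idom_generalized_inverse[of A] by blast
  define At Ht where "At = (\<lambda>t. Q + t *\<^sub>R R)" and "Ht = (\<lambda>t. (\<chi> i j. poly (H $ i $ j) t))"
  define G where "G = (\<lambda>t. Ht t + transpose (Ht t))"
  have At: "At t $ i $ j = poly (A $ i $ j) t" for t i j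
    by (simp add: At_def A_def)
  have tr: "transpose (At t) = At t" for t
    using assms by (simp add: At_def transpose_def vec_eq_iff)
  have 1: "At t ** Ht t ** At t = poly D t *\<^sub>R At t" for t
  proof -
    have "(At t ** Ht t ** At t) $ i $ j = poly ((A ** H ** A) $ i $ j) t" for i j
      by (simp add: matrix_matrix_mult_def poly_sum At Ht_def)
    then show ?thesis by (simp add: vec_eq_iff H At)
  qed
  have 2: "At t ** transpose (Ht t) ** At t = poly D t *\<^sub>R At t" for t
  proof -
    have "transpose (At t ** Ht t ** At t) = poly D t *\<^sub>R At t"
      unfolding 1 using tr by (simp add: transpose_def vec_eq_iff)
    then show ?thesis by (simp add: matrix_transpose_mul tr matrix_mul_assoc)
  qed
  have "At t ** G t ** At t = poly (smult 2 D) t *\<^sub>R At t" for t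
    unfolding G_def
    by (simp add: matrix_add_ldistrib matrix_mult_add_rdistrib 1 2 flip: scaleR_left_distrib)
  moreover have "transpose (G t) = G t" for t
    by (simp add: G_def transpose_def vec_eq_iff)
  moreover have "polynomial_fun (\<lambda>t. G t $ i $ j)" for i j
    unfolding G_def Ht_def by (simp add: transpose_def) (intro polynomial_fun_add polynomial_fun_poly)
  moreover have "smult 2 D \<noteq> 0" using D by simp
  ultimately show ?thesis unfolding At_def by (intro exI[of _ G] exI[of _ "smult 2 D"]) auto
qed

lemma polynomial_fun_matrix_vector:
  fixes G :: "real \<Rightarrow> real ^ 'n ^ 'm"
  assumes "\<And>i j. polynomial_fun (\<lambda>t. G t $ i $ j)" "\<And>j. polynomial_fun (\<lambda>t. b t $ j)"
  shows "polynomial_fun (\<lambda>t. (G t *v b t) $ i)"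
  unfolding matrix_vector_mult_def using assms by (auto intro!: polynomial_fun_sum polynomial_fun_mult)

lemma polynomial_fun_inner:
  fixes a b :: "real \<Rightarrow> real ^ 'n"
  assumes "\<And>i. polynomial_fun (\<lambda>t. a t $ i)" "\<And>i. polynomial_fun (\<lambda>t. b t $ i)"
  shows "polynomial_fun (\<lambda>t. a t \<bullet> b t)"
  unfolding inner_vec_def using assms by (auto intro!: polynomial_fun_sum polynomial_fun_mult)

definition quad_form :: "real ^ 'n ^ 'n \<Rightarrow> real ^ 'n \<Rightarrow> real \<Rightarrow> real ^ 'n \<Rightarrow> real" where
  "quad_form Q c d x = x \<bullet> (Q *v x) / 2 + c \<bullet> x + d"

text \<open>
  Applied with \<open>\<tau>\<close> the difference of two parameters. As A G acts as the scalar \<open>\<delta>\<close> on b and on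
  A s, it also does so on \<open>\<tau> g\<close>, and the mixed terms of the expansion reduce to inner products with s.
\<close>
lemma inner_generalized_inverse:
  fixes A G :: "real ^ 'n ^ 'n"
  assumes sym: "transpose A = A" "transpose G = G" and AGA: "A ** G ** A = \<delta> *\<^sub>R A"
    and AGb: "A *v (G *v b) = \<delta> *\<^sub>R b" and b: "b = \<tau> *\<^sub>R g - A *v s"
  shows "b \<bullet> (G *v b) = \<tau>\<^sup>2 * (g \<bullet> (G *v g)) - \<delta> * (2 * \<tau> * (s \<bullet> g) - s \<bullet> (A *v s))"
proof -
  have AGAs: "A *v (G *v (A *v s)) = \<delta> *\<^sub>R (A *v s)"
    using arg_cong[OF AGA, of "\<lambda>M. M *v s"]
    by (simp add: matrix_vector_mul_assoc matrix_mul_assoc scaleR_matrix_vector_assoc)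
  have "A *v (G *v b) = \<tau> *\<^sub>R (A *v (G *v g)) - \<delta> *\<^sub>R (A *v s)"
    unfolding b by (simp add: matrix_vector_mult_diff_distrib matrix_vector_mult_scaleR AGAs)
  then have "\<tau> *\<^sub>R (A *v (G *v g)) = \<delta> *\<^sub>R b + \<delta> *\<^sub>R (A *v s)"
    unfolding AGb by simp
  then have AGg: "\<tau> *\<^sub>R (A *v (G *v g)) = (\<delta> * \<tau>) *\<^sub>R g"
    by (simp add: b algebra_simps)
  have 1: "(A *v s) \<bullet> (G *v (A *v s)) = \<delta> * (s \<bullet> (A *v s))"
    by (subst inner_commute, subst symmetric_inner[OF sym(1)]) (simp add: AGAs)
  have "(A *v s) \<bullet> (G *v g) = s \<bullet> (A *v (G *v g))"
    by (subst inner_commute) (rule symmetric_inner[OF sym(1)])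
  then have "\<tau> * ((A *v s) \<bullet> (G *v g)) = s \<bullet> (\<tau> *\<^sub>R (A *v (G *v g)))"
    by simp
  then have 2: "\<tau> * ((A *v s) \<bullet> (G *v g)) = \<delta> * \<tau> * (s \<bullet> g)"
    unfolding AGg by simp
  have 3: "g \<bullet> (G *v (A *v s)) = (A *v s) \<bullet> (G *v g)"
    by (rule symmetric_inner[OF sym(2)])
  have "b \<bullet> (G *v b) = \<tau>\<^sup>2 * (g \<bullet> (G *v g))
      - 2 * (\<tau> * ((A *v s) \<bullet> (G *v g))) + (A *v s) \<bullet> (G *v (A *v s))"
    unfolding b
    by (simp add: matrix_vector_mult_diff_distrib matrix_vector_mult_scaleR inner_diff_left
        inner_diff_right 3 power2_eq_square algebra_simps)
  then show ?thesis unfolding 1 2 by (simp add: algebra_simps)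
qed

text \<open>
  The pairs in C are the critical points of the Lagrangian \<open>q + t r\<close> that satisfy the constraint
  \<open>r = 0\<close>. For a fixed multiplier t, all critical points of the quadratic \<open>q + t r\<close> have the same value,
  so only the case of infinitely many multipliers matters. Then the linear system \<open>A t s = - b t\<close> is
  solvable for infinitely many t, hence the polynomial identity \<open>A G b = D b\<close> holds for all t, and
  the critical value of \<open>q + t r\<close> is the rational function \<open>N / (2 D)\<close>. Its derivative with respect to
  t is the value of r at the critical point, so it vanishes at each multiplier that occurs in C.
  In polynomial terms, \<open>N - 2 q(s) D\<close> has a double root there, whence the Wronskian of N and D has
  infinitely many zeros and N is a constant multiple of D.
\<close>
lemma finite_critical_values_on_zero_set:
  fixes Q R :: "real ^ 'n ^ 'n" and c e :: "real ^ 'n" and d f :: real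
  assumes sym: "transpose Q = Q" "transpose R = R"
  defines "q \<equiv> quad_form Q c d" and "r \<equiv> quad_form R e f"
  defines "C \<equiv> {(t, s). (Q + t *\<^sub>R R) *v s + (c + t *\<^sub>R e) = 0 \<and> r s = 0}"
  shows "finite ((\<lambda>(t, s). q s) ` C)"
proof -
  define A where "A = (\<lambda>t. Q + t *\<^sub>R R)"
  define b where "b = (\<lambda>t. c + t *\<^sub>R e)"
  have C: "A t *v s = - b t" "r s = 0" if "(t, s) \<in> C" for t s
    using that by (auto simp: C_def A_def b_def eq_neg_iff_add_eq_0 simp del: minus_add_distrib)
  have symA: "transpose (A t) = A t" for t
    using sym by (simp add: A_def transpose_def vec_eq_iff)
  have critical: "q s = (b t \<bullet> s) / 2 + d + t * f" if "(t, s) \<in> C" for t s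
  proof -
    have "s \<bullet> (A t *v s) / 2 + b t \<bullet> s + d + t * f = q s + t * r s"
      by (simp add: q_def r_def quad_form_def A_def b_def matrix_vector_mult_add_rdistrib
          scaleR_matrix_vector_assoc[symmetric] inner_add_left inner_add_right field_simps)
    then show ?thesis using C[OF that] by (simp add: inner_commute)
  qed
  have single: "q s = q s'" if "(t, s) \<in> C" "(t, s') \<in> C" for t s s'
  proof -
    have "b t \<bullet> s = - (s \<bullet> (A t *v s'))" using C[OF that(2)] by (simp add: inner_commute)
    also have "\<dots> = - (s' \<bullet> (A t *v s))" by (simp only: symmetric_inner[OF symA[of t], of s s'])
    also have "\<dots> = b t \<bullet> s'" using C[OF that(1)] by (simp add: inner_commute)
    finally show ?thesis using critical[OF that(1)] critical[OF that(2)] by simp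
  qed
  have fin: "finite ((\<lambda>(t, s). q s) ` {p \<in> C. fst p \<in> T})" if "finite T" for T
  proof -
    have "q s = q (SOME s. (t, s) \<in> C)" if "(t, s) \<in> C" for t s
      by (rule single[OF that]) (rule someI[of "\<lambda>s. (t, s) \<in> C", OF that])
    then have "(\<lambda>(t, s). q s) ` {p \<in> C. fst p \<in> T} \<subseteq> (\<lambda>t. q (SOME s. (t, s) \<in> C)) ` T"
      by auto
    then show ?thesis using that finite_surj by blast
  qed
  show ?thesis
  proof (cases "finite (fst ` C)")
    case True
    have "{p \<in> C. fst p \<in> fst ` C} = C" by auto
    then show ?thesis using fin[OF True] by simp
  next
    case inf: False
    obtain G D where D: "D \<noteq> 0" and symG: "\<And>t. transpose (G t) = G t"
      and polyG: "\<And>i j. polynomial_fun (\<lambda>t. G t $ i $ j)"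
      and AGA: "\<And>t. A t ** G t ** A t = poly D t *\<^sub>R A t"
      using symmetric_pencil_generalized_inverse[OF sym] unfolding A_def by metis
    have polyA: "polynomial_fun (\<lambda>t. A t $ i $ j)" for i j
      unfolding A_def by (auto intro!: polynomial_fun_add polynomial_fun_mult)
    have polyb: "polynomial_fun (\<lambda>t. b t $ i)" for i
      unfolding b_def by (auto intro!: polynomial_fun_add polynomial_fun_mult)
    have AGA': "A t *v (G t *v (A t *v s)) = poly D t *\<^sub>R (A t *v s)" for t s
      using arg_cong[OF AGA[of t], of "\<lambda>M. M *v s"]
      by (simp add: matrix_vector_mul_assoc matrix_mul_assoc scaleR_matrix_vector_assoc)
    have AGb: "A t *v (G t *v b t) = poly D t *\<^sub>R b t" for t
    proof -
      have "(A t *v (G t *v b t)) $ i = (poly D t *\<^sub>R b t) $ i" for i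
      proof (rule polynomial_fun_eqI[where f = "\<lambda>t. (A t *v (G t *v b t)) $ i"
              and g = "\<lambda>t. (poly D t *\<^sub>R b t) $ i"])
        show "polynomial_fun (\<lambda>t. (A t *v (G t *v b t)) $ i)"
          by (intro polynomial_fun_matrix_vector polyA polyG polyb)
        show "polynomial_fun (\<lambda>t. (poly D t *\<^sub>R b t) $ i)"
          using polyb by auto
        have "A t *v (G t *v b t) = poly D t *\<^sub>R b t" if "t \<in> fst ` C" for t
        proof -
          from that obtain s where "(t, s) \<in> C" by force
          then have "b t = - (A t *v s)" using C by simp
          then show ?thesis using AGA'[of t s]
            by (metis minus_equation_iff scaleR_minus_right vec.neg)
        qed
        then have "fst ` C \<subseteq> {t. (A t *v (G t *v b t)) $ i = (poly D t *\<^sub>R b t) $ i}"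
          by (intro subsetI CollectI) (rule arg_cong)
        then show "infinite {t. (A t *v (G t *v b t)) $ i = (poly D t *\<^sub>R b t) $ i}"
          using inf infinite_super by blast
      qed
      then show ?thesis by (simp add: vec_eq_iff)
    qed
    \<comment> \<open>At a critical point s of q + t r one has b = - A s, so b G b = D (s A s) and the critical
      value d + t f - (s A s) / 2 equals N / (2 D).\<close>
    have "polynomial_fun (\<lambda>t. 2 * poly D t * (d + t * f) - b t \<bullet> (G t *v b t))"
      by (intro polynomial_fun_diff polynomial_fun_mult polynomial_fun_add polynomial_fun_const
          polynomial_fun_ident polynomial_fun_poly polynomial_fun_inner polynomial_fun_matrix_vector
          polyG polyb)
    then obtain N where N: "\<And>t. poly N t = 2 * poly D t * (d + t * f) - b t \<bullet> (G t *v b t)"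
      unfolding polynomial_fun_def by metis
    \<comment> \<open>For D(t) nonzero: the rational function N / (2 D) has value q(s) and derivative zero at t.\<close>
    have double: "\<exists>K. N = smult (2 * q s) D - [:-t, 1:]\<^sup>2 * K" if ts: "(t, s) \<in> C" for t s
    proof -
      \<comment> \<open>The gradient of r at s: moving the multiplier from t to u changes the gradient of the
        Lagrangian at s from zero to (u - t) g.\<close>
      define g where "g = R *v s + e"
      have "polynomial_fun (\<lambda>u. g \<bullet> (G u *v g))"
        by (intro polynomial_fun_inner polynomial_fun_matrix_vector polynomial_fun_const polyG)
      then obtain K where K: "\<And>u. poly K u = g \<bullet> (G u *v g)"
        unfolding polynomial_fun_def by metis
      have b: "b u = (u - t) *\<^sub>R g - A u *v s" for u
      proof -
        have "b u + A u *v s = (b t + A t *v s) + (u - t) *\<^sub>R g"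
          by (simp add: b_def A_def g_def matrix_vector_mult_add_rdistrib
              scaleR_matrix_vector_assoc[symmetric] algebra_simps)
        then show ?thesis using C[OF ts] by (simp add: algebra_simps)
      qed
      have "poly N u = poly (smult (2 * q s) D - [:-t, 1:]\<^sup>2 * K) u" for u
      proof -
        have bGb: "b u \<bullet> (G u *v b u) = (u - t)\<^sup>2 * poly K u
            - poly D u * (2 * (u - t) * (s \<bullet> g) - s \<bullet> (A u *v s))"
          unfolding K by (rule inner_generalized_inverse[OF symA symG AGA AGb b])
        have sAs: "s \<bullet> (A u *v s) = (u - t) * (s \<bullet> g) - b u \<bullet> s"
          by (subst inner_commute[of "b u"]) (simp add: b inner_diff_right)
        have "q s + u * r s = s \<bullet> (A u *v s) / 2 + b u \<bullet> s + d + u * f"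
          by (simp add: q_def r_def quad_form_def A_def b_def matrix_vector_mult_add_rdistrib
              scaleR_matrix_vector_assoc[symmetric] inner_add_left inner_add_right field_simps)
        then have "2 * (d + u * f) + 2 * (u - t) * (s \<bullet> g) - s \<bullet> (A u *v s) = 2 * q s"
          using C(2)[OF ts] sAs by (simp add: field_simps)
        from arg_cong[OF this, of "\<lambda>v. poly D u * v"] show ?thesis
          unfolding N bGb by (simp add: algebra_simps power2_eq_square)
      qed
      then have "N = smult (2 * q s) D - [:-t, 1:]\<^sup>2 * K" by (simp add: poly_eq_poly_eq_iff[symmetric] fun_eq_iff)
      then show ?thesis by blast
    qed
    have wronskian: "pderiv N * D = N * pderiv D"
    proof -
      have "poly (pderiv N * D - N * pderiv D) t = 0" if "t \<in> fst ` C" for t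
      proof -
        from that obtain s where "(t, s) \<in> C" by force
        then obtain K where N': "N = smult (2 * q s) D - [:-t, 1:]\<^sup>2 * K" using double by blast
        define M where "M = [:-t, 1:] * K"
        have "N = smult (2 * q s) D - [:-t, 1:] * M"
          unfolding N' M_def power2_eq_square by (simp only: mult.assoc)
        moreover have "poly M t = 0" by (simp add: M_def)
        ultimately show ?thesis
          by (simp add: pderiv_diff pderiv_smult pderiv_mult del: mult_pCons_left mult_pCons_right)
      qed
      then have "fst ` C \<subseteq> {t. poly (pderiv N * D - N * pderiv D) t = 0}" by blast
      then have "infinite {t. poly (pderiv N * D - N * pderiv D) t = 0}" using inf infinite_super by blast
      then have "pderiv N * D - N * pderiv D = 0" using poly_roots_finite by blast
      then show ?thesis by simp
    qed
    obtain k where k: "N = smult k D" using wronskian_zero_imp_proportional[OF wronskian D] by blast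
    have "q s = k / 2" if ts: "(t, s) \<in> C" and t: "poly D t \<noteq> 0" for t s
    proof -
      obtain K where "N = smult (2 * q s) D - [:-t, 1:]\<^sup>2 * K" using double[OF ts] by blast
      from arg_cong[OF this, of "\<lambda>p. poly p t"] show ?thesis using t k by simp
    qed
    then have "(\<lambda>(t, s). q s) ` C \<subseteq> insert (k / 2) ((\<lambda>(t, s). q s) ` {p \<in> C. fst p \<in> {t. poly D t = 0}})"
      by (force simp: image_iff)
    moreover have "finite ((\<lambda>(t, s). q s) ` {p \<in> C. fst p \<in> {t. poly D t = 0}})"
      by (rule fin) (rule poly_roots_finite[OF D])
    ultimately show ?thesis using finite_subset by blast
  qed
qed

section \<open>Differences of maxima of two quadratic functions\<close>

lemma quadratic_fun_quad_form:
  assumes "quadratic_fun q"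
  shows "\<exists>Q c d. transpose Q = Q \<and> q = quad_form Q c d"
proof -
  obtain P c d where q: "\<And>x. q x = x \<bullet> (P *v x) + c \<bullet> x + d"
    using assms unfolding quadratic_fun_def by blast
  have "transpose (P + transpose P) = P + transpose P"
    by (simp add: transpose_def vec_eq_iff)
  moreover have "x \<bullet> (transpose P *v x) = x \<bullet> (P *v x)" for x
    by (simp add: transpose_matrix_vector inner_commute[of x] dot_lmul_matrix)
  then have "q = quad_form (P + transpose P) c d"
    by (simp add: fun_eq_iff q quad_form_def matrix_vector_mult_add_rdistrib inner_add_right)
  ultimately show ?thesis by blast
qed

lemma slope_quad_form:
  assumes "transpose Q = Q"
  shows "slope (quad_form Q c d) x v = (Q *v x + c) \<bullet> v"
proof -
  have "v \<bullet> (Q *v x) = x \<bullet> (Q *v v)" by (rule symmetric_inner[OF assms])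
  then show ?thesis
    by (simp add: slope_def quad_form_def matrix_vector_right_distrib matrix_vector_mult_diff_distrib
        inner_add_left inner_add_right inner_diff_left inner_diff_right inner_commute[of _ v] field_simps)
qed

lemma quadratic_fun_affine_substitution:
  fixes q :: "real ^ 'm \<Rightarrow> real" and B :: "real ^ 'n \<Rightarrow> real ^ 'm"
  assumes "quadratic_fun q" "linear B"
  shows "quadratic_fun (\<lambda>s. q (z + B s))"
proof -
  obtain Q c d where q: "\<And>x. q x = x \<bullet> (Q *v x) + c \<bullet> x + d"
    using assms(1) unfolding quadratic_fun_def by blast
  define M where "M = matrix B"
  have B: "B s = M *v s" for s using assms(2) by (simp add: M_def matrix_works)
  have tr: "w \<bullet> (M *v s) = (transpose M *v w) \<bullet> s" for w s
    by (simp add: transpose_matrix_vector dot_lmul_matrix)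
  have tr2: "(M *v s) \<bullet> w = (transpose M *v w) \<bullet> s" for w s
    using tr by (simp add: inner_commute)
  have tr3: "w \<bullet> (Q *v (M *v s)) = (transpose M *v (transpose Q *v w)) \<bullet> s" for w s
    by (simp add: transpose_matrix_vector dot_lmul_matrix)
  have "q (z + B s) = s \<bullet> ((transpose M ** Q ** M) *v s)
      + (transpose M *v (transpose Q *v z) + transpose M *v (Q *v z) + transpose M *v c) \<bullet> s + q z" for s
  proof -
    have "(M *v s) \<bullet> (Q *v (M *v s)) = s \<bullet> ((transpose M ** Q ** M) *v s)"
      by (subst tr2) (simp only: matrix_vector_mul_assoc[symmetric] inner_commute)
    then show ?thesis
      unfolding q B
      by (simp add: matrix_vector_right_distrib inner_add_left inner_add_right
          tr3[of z] tr[of c] tr2[of _ "Q *v z"])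
  qed
  then show ?thesis unfolding quadratic_fun_def by blast
qed

text \<open>
  Otherwise a hyperplane would strictly separate 0 from the segment between a and b.
\<close>
lemma convex_combination_zero:
  fixes a b :: "'a::euclidean_space"
  assumes "\<And>u. 0 \<le> a \<bullet> u \<or> 0 \<le> b \<bullet> u"
  shows "\<exists>t. b + t *\<^sub>R (a - b) = 0"
proof -
  have "0 \<in> closed_segment b a"
  proof (rule ccontr)
    assume "0 \<notin> closed_segment b a"
    then obtain w k where w: "0 < k" "\<forall>x\<in>closed_segment b a. k < w \<bullet> x"
      using separating_hyperplane_closed_0[of "closed_segment b a"] by auto
    have "0 < w \<bullet> a" "0 < w \<bullet> b" using w less_trans by auto
    then show False using assms[of "- w"] by (simp add: inner_commute)
  qed
  then obtain t where "0 = (1 - t) *\<^sub>R b + t *\<^sub>R a" unfolding closed_segment_def by blast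
  then show ?thesis by (intro exI[of _ t]) (simp add: algebra_simps)
qed

text \<open>
  Substituting an affine parametrization of the affine hull of the cell removes the polyhedral
  constraint. Stationarity says that the gradients of the two pulled back quadratics are not both
  negative along any direction, so some affine combination of them vanishes: the points are critical
  points of the second quadratic on the zero set of the difference of the two.
\<close>
lemma finite_stationary_values_both_active:
  fixes q1 q2 :: "real ^ 'n \<Rightarrow> real" and z :: "real ^ 'n"
  assumes A: "finite A" "union_of_cells A X" and q: "quadratic_fun q1" "quadratic_fun q2"
    and major: "\<And>w. \<psi> w \<le> max (q1 w) (q2 w)"
  defines "S \<equiv> {x \<in> d_stationary \<psi> X. cell_sig A x = cell_sig A z \<and> q1 x = \<psi> x \<and> q2 x = \<psi> x}"
  shows "finite (\<psi> ` S)"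
proof -
  \<comment> \<open>A linear projection B onto the directions of the cell; s = x - z parametrizes the cell of z.\<close>
  have "inj_on id (cell_dirs A z)" "linear (id :: real ^ 'n \<Rightarrow> real ^ 'n)" by (auto intro: linear_id)
  then obtain B :: "real ^ 'n \<Rightarrow> real ^ 'n" where B: "range B \<subseteq> cell_dirs A z" "linear B"
      "\<forall>v\<in>cell_dirs A z. B v = v"
    using real_vector.linear_exists_left_inverse_on[of id "cell_dirs A z"] subspace_cell_dirs[of A z] by auto
  obtain Q c d where Q: "transpose Q = Q" "(\<lambda>s. q1 (z + B s)) = quad_form Q c d"
    using quadratic_fun_quad_form[OF quadratic_fun_affine_substitution[OF q(1) B(2)]] by blast
  obtain P b e where P: "transpose P = P" "(\<lambda>s. q2 (z + B s)) = quad_form P b e"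
    using quadratic_fun_quad_form[OF quadratic_fun_affine_substitution[OF q(2) B(2)]] by blast
  define C where "C = {(t, s). (P + t *\<^sub>R (Q - P)) *v s + (b + t *\<^sub>R (c - b)) = 0 \<and>
      quad_form (Q - P) (c - b) (d - e) s = 0}"
  have "transpose (Q - P) = Q - P" using Q(1) P(1) by (simp add: transpose_def vec_eq_iff)
  then have "finite ((\<lambda>(t, s). quad_form P b e s) ` C)"
    unfolding C_def by (rule finite_critical_values_on_zero_set[OF P(1)])
  moreover have "\<psi> ` S \<subseteq> (\<lambda>(t, s). quad_form P b e s) ` C"
  proof (rule image_subsetI)
    fix x assume "x \<in> S"
    then have x: "x \<in> d_stationary \<psi> X" "cell_sig A x = cell_sig A z" "q1 x = \<psi> x" "q2 x = \<psi> x"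
      by (auto simp: S_def)
    then have xX: "x \<in> X" by (simp add: d_stationary_def)
    define s where "s = x - z"
    have "B s = x - z" unfolding s_def using B(3) diff_in_cell_dirs[OF x(2)[symmetric]] by blast
    then have zB: "z + B s = x" by simp
    have slopes: "slope q1 x (B u) = (Q *v s + c) \<bullet> u" "slope q2 x (B u) = (P *v s + b) \<bullet> u" for u
    proof -
      have add: "z + B (s + u) = x + B u" "z + B (s - u) = x - B u"
        using zB linear_add[OF B(2)] linear_diff[OF B(2)] by (auto simp: algebra_simps)
      have "slope q1 x (B u) = slope (\<lambda>s. q1 (z + B s)) s u" unfolding slope_def add ..
      then show "slope q1 x (B u) = (Q *v s + c) \<bullet> u" unfolding Q(2) slope_quad_form[OF Q(1)] .
      have "slope q2 x (B u) = slope (\<lambda>s. q2 (z + B s)) s u" unfolding slope_def add ..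
      then show "slope q2 x (B u) = (P *v s + b) \<bullet> u" unfolding P(2) slope_quad_form[OF P(1)] .
    qed
    have "0 \<le> (Q *v s + c) \<bullet> u \<or> 0 \<le> (P *v s + b) \<bullet> u" for u
    proof -
      have dir: "B u \<in> cell_dirs A x" using B(1) cell_dirs_cong[OF x(2)] by auto
      define p where "p = (\<lambda>i::bool. if i then q1 else q2)"
      have "\<exists>i\<in>UNIV. p i x = \<psi> x \<and> 0 \<le> slope (p i) x (B u)"
      proof (rule stationary_active_slope[OF x(1) eventually_in_union_of_cells[OF A xX dir]])
        show "\<forall>\<^sub>F t in at_right 0. \<exists>i\<in>UNIV. \<psi> (x + t *\<^sub>R B u) \<le> p i (x + t *\<^sub>R B u)"
        proof (intro always_eventually allI)
          fix t
          have "\<psi> (x + t *\<^sub>R B u) \<le> p True (x + t *\<^sub>R B u) \<or> \<psi> (x + t *\<^sub>R B u) \<le> p False (x + t *\<^sub>R B u)"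
            using major[of "x + t *\<^sub>R B u"] by (simp add: p_def max_def split: if_splits)
          then show "\<exists>i\<in>UNIV. \<psi> (x + t *\<^sub>R B u) \<le> p i (x + t *\<^sub>R B u)" by blast
        qed
      qed (use q x in \<open>auto simp: p_def\<close>)
      then show ?thesis unfolding slopes[symmetric] by (auto simp: p_def split: if_splits)
    qed
    from convex_combination_zero[OF this]
    obtain t where "(P *v s + b) + t *\<^sub>R ((Q *v s + c) - (P *v s + b)) = 0" ..
    then have "(P + t *\<^sub>R (Q - P)) *v s + (b + t *\<^sub>R (c - b)) = 0"
      by (simp add: matrix_vector_mult_add_rdistrib matrix_vector_mult_diff_rdistrib
          scaleR_matrix_vector_assoc[symmetric] algebra_simps)
    moreover have val: "quad_form Q c d s = \<psi> x" "quad_form P b e s = \<psi> x"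
      using fun_cong[OF Q(2), of s] fun_cong[OF P(2), of s] zB x(3,4) by auto
    then have "quad_form (Q - P) (c - b) (d - e) s = 0"
      by (simp add: quad_form_def matrix_vector_mult_diff_rdistrib inner_diff_left inner_diff_right
          field_simps)
    ultimately have "(t, s) \<in> C" by (simp add: C_def)
    then show "\<psi> x \<in> (\<lambda>(t, s). quad_form P b e s) ` C" using val(2) by force
  qed
  ultimately show ?thesis using finite_subset by blast
qed

text \<open>
  If only q2 touches, it is by continuity a majorant near the point, and the argument for a single
  quadratic applies.
\<close>
lemma finite_stationary_values_one_active:
  fixes q1 q2 :: "real ^ 'n \<Rightarrow> real" and z :: "real ^ 'n"
  assumes A: "finite A" "union_of_cells A X" and q: "quadratic_fun q1" "quadratic_fun q2"
    and major: "\<And>w. \<psi> w \<le> max (q1 w) (q2 w)"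
  defines "S \<equiv> {x \<in> d_stationary \<psi> X. cell_sig A x = cell_sig A z \<and> q1 x < \<psi> x \<and> q2 x = \<psi> x}"
  shows "finite (\<psi> ` S)"
proof (rule finite_values_determined_by_signature[where s = "\<lambda>_. ()"])
  have near: "\<forall>\<^sub>F w in nhds x. \<psi> w \<le> q2 w" if "x \<in> S" for x
  proof -
    have "q1 x - q2 x < 0" using that by (simp add: S_def)
    moreover have "isCont (\<lambda>w. q1 w - q2 w) x"
      using quadratic_fun_continuous[OF quadratic_fun_diff[OF q], of UNIV]
      by (simp add: continuous_on_eq_continuous_at)
    then have "((\<lambda>w. q1 w - q2 w) \<longlongrightarrow> q1 x - q2 x) (nhds x)"
      using tendsto_at_iff_tendsto_nhds[of "\<lambda>w. q1 w - q2 w" x] by (simp add: isCont_def)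
    ultimately have "\<forall>\<^sub>F w in nhds x. q1 w - q2 w < 0"
      by (intro order_tendstoD(2))
    then show ?thesis
    proof eventually_elim
      case (elim w)
      then show ?case using major[of w] by simp
    qed
  qed
  fix x y assume xy: "x \<in> S" "y \<in> S"
  then have "cell_sig A x = cell_sig A y" "x \<in> d_stationary \<psi> X" "y \<in> d_stationary \<psi> X"
    "\<psi> x = q2 x" "\<psi> y = q2 y" by (auto simp: S_def)
  then show "\<psi> x = \<psi> y"
    using near[OF xy(1)] near[OF xy(2)]
    by (intro stationary_values_eq_on_cell[OF A _ _ _ q(2)]) (auto elim: eventually_mono)
qed simp

lemma finite_stationary_values_max2_minus_max2:
  assumes X: "polyhedron X" and "max2_minus_max2_quadratic \<psi>"
  shows "finite (\<psi> ` d_stationary \<psi> X)"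
proof -
  obtain a1 a2 b1 b2 where quad: "quadratic_fun a1" "quadratic_fun a2" "quadratic_fun b1" "quadratic_fun b2"
    and \<psi>: "\<And>x. \<psi> x = max (a1 x) (a2 x) - max (b1 x) (b2 x)"
    using assms(2) unfolding max2_minus_max2_quadratic_def by blast
  obtain A where A: "finite A" "union_of_cells A X" using polyhedron_union_of_cells[OF X] by blast
  define D where "D = d_stationary \<psi> X"
  define sg where "sg = (\<lambda>x. (cell_sig A x, b1 x \<ge> b2 x))"
  have "finite (sg ` D)" unfolding sg_def by (intro finite_pair_image finite_cell_sigs A(1)) simp
  then show ?thesis unfolding D_def[symmetric]
  proof (rule finite_values_by_signature)
    fix z assume "z \<in> D"
    \<comment> \<open>The piece of the second maximum that is active at all points of the class of z.\<close>
    define b where "b = (if b1 z \<ge> b2 z then b1 else b2)"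
    define q1 where "q1 = (\<lambda>x. a1 x - b x)"
    define q2 where "q2 = (\<lambda>x. a2 x - b x)"
    have "quadratic_fun b" using quad by (simp add: b_def)
    then have q: "quadratic_fun q1" "quadratic_fun q2"
      using quad by (auto simp: q1_def q2_def intro: quadratic_fun_diff)
    have major: "\<psi> w \<le> max (q1 w) (q2 w)" "\<psi> w \<le> max (q2 w) (q1 w)" for w
      by (auto simp: \<psi> q1_def q2_def b_def max_def)
    define S where "S = (\<lambda>P. {x \<in> D. cell_sig A x = cell_sig A z \<and> P x})"
    have "{x \<in> D. sg x = sg z} \<subseteq> S (\<lambda>x. q1 x = \<psi> x \<and> q2 x = \<psi> x) \<union>
        (S (\<lambda>x. q1 x < \<psi> x \<and> q2 x = \<psi> x) \<union> S (\<lambda>x. q2 x < \<psi> x \<and> q1 x = \<psi> x))"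
    proof
      fix x assume x: "x \<in> {x \<in> D. sg x = sg z}"
      then have "b x = max (b1 x) (b2 x)" by (auto simp: sg_def b_def max_def)
      then have "\<psi> x = max (q1 x) (q2 x)" by (simp add: \<psi> q1_def q2_def max_def)
      then have "(q1 x = \<psi> x \<and> q2 x = \<psi> x) \<or> (q1 x < \<psi> x \<and> q2 x = \<psi> x) \<or> (q2 x < \<psi> x \<and> q1 x = \<psi> x)"
        by (simp add: max_def split: if_splits) linarith
      then show "x \<in> S (\<lambda>x. q1 x = \<psi> x \<and> q2 x = \<psi> x) \<union>
        (S (\<lambda>x. q1 x < \<psi> x \<and> q2 x = \<psi> x) \<union> S (\<lambda>x. q2 x < \<psi> x \<and> q1 x = \<psi> x))"
        using x by (auto simp: S_def sg_def)
    qed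
    then have "\<psi> ` {x \<in> D. sg x = sg z} \<subseteq> \<psi> ` S (\<lambda>x. q1 x = \<psi> x \<and> q2 x = \<psi> x) \<union>
        (\<psi> ` S (\<lambda>x. q1 x < \<psi> x \<and> q2 x = \<psi> x) \<union> \<psi> ` S (\<lambda>x. q2 x < \<psi> x \<and> q1 x = \<psi> x))"
      by (simp only: image_Un[symmetric] image_mono)
    moreover have "finite (\<psi> ` S (\<lambda>x. q1 x = \<psi> x \<and> q2 x = \<psi> x))"
      unfolding S_def D_def by (rule finite_stationary_values_both_active[OF A q major(1)])
    moreover have "finite (\<psi> ` S (\<lambda>x. q1 x < \<psi> x \<and> q2 x = \<psi> x))"
      unfolding S_def D_def by (rule finite_stationary_values_one_active[OF A q major(1)])
    moreover have "finite (\<psi> ` S (\<lambda>x. q2 x < \<psi> x \<and> q1 x = \<psi> x))"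
      unfolding S_def D_def by (rule finite_stationary_values_one_active[OF A q(2,1) major(2)])
    ultimately show "finite (\<psi> ` {x \<in> D. sg x = sg z})"
      by (meson finite_subset finite_UnI)
  qed
qed

lemma max2_minus_max2_quadratic_uminus:
  assumes "max2_minus_max2_quadratic \<psi>"
  shows "max2_minus_max2_quadratic (\<lambda>x. - \<psi> x)"
proof -
  from assms obtain a1 a2 b1 b2 where
    "quadratic_fun a1" "quadratic_fun a2" "quadratic_fun b1" "quadratic_fun b2"
    "\<forall>x. \<psi> x = max (a1 x) (a2 x) - max (b1 x) (b2 x)"
    unfolding max2_minus_max2_quadratic_def by blast
  then show ?thesis
    unfolding max2_minus_max2_quadratic_def
    by (intro exI[of _ b1] exI[of _ b2] exI[of _ a1] exI[of _ a2]) simp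
qed

lemma quadratic_selection_on_max2:
  assumes "quadratic_fun a" "quadratic_fun b"
  shows "quadratic_selection_on X (\<lambda>x. max (a x) (b x))"
proof -
  have "continuous_on X (\<lambda>x. max (a x) (b x))"
    by (intro continuous_on_max quadratic_fun_continuous assms)
  moreover have "\<exists>h\<in>{a, b}. max (a x) (b x) = h x" for x by (auto simp: max_def)
  ultimately show ?thesis
    unfolding quadratic_selection_on_def using assms by (intro conjI exI[of _ "{a, b}"]) auto
qed

section \<open>The composite program\<close>

lemma finite_composite_stationary_values:
  assumes "polyhedron X" "convex_on UNIV \<phi> \<or> concave_on UNIV \<phi>" "quadratic_selection_on X \<psi>"
    and "finite (\<psi> ` d_stationary \<psi> X)" "finite ((\<lambda>x. - \<psi> x) ` d_stationary (\<lambda>x. - \<psi> x) X)"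
  shows "finite ((\<phi> \<circ> \<psi>) ` d_stationary (\<phi> \<circ> \<psi>) X)"
  by (rule finite_composite_values[OF assms(2) quadratic_selection_has_dir_deriv[OF assms(3)]])
    (use assms polyhedron_imp_convex in auto)

theorem proposition11:
  fixes X :: "(real ^ 'n) set" and \<phi> :: "real \<Rightarrow> real" and \<psi> :: "real ^ 'n \<Rightarrow> real"
  assumes "polyhedron X"
    and "convex_on UNIV \<phi> \<or> concave_on UNIV \<phi>"
    and "plq_on_superset X \<psi> \<or>
         affine_plus_max_convex_quadratic \<psi> \<or>
         max2_minus_max2_quadratic \<psi> \<or>
         max_concave_minus_max_strictly_convex X \<psi>"
  shows "finite ((\<phi> \<circ> \<psi>) ` d_stationary (\<phi> \<circ> \<psi>) X)"
  using assms(3)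
proof (elim disjE)
  assume \<psi>: "plq_on_superset X \<psi>"
  show ?thesis
    by (intro finite_composite_stationary_values assms plq_on_superset_selection \<psi>
        finite_stationary_values_plq plq_on_superset_uminus)
next
  assume "affine_plus_max_convex_quadratic \<psi>"
  then obtain g k f where "1 \<le> (k::nat)" and g: "piecewise_affine g"
    and f: "\<forall>i\<in>{1..k}. quadratic_fun (f i) \<and> convex_on UNIV (f i)"
    and "\<forall>x. \<psi> x = g x + Max ((\<lambda>i. f i x) ` {1..k})"
    unfolding affine_plus_max_convex_quadratic_def by blast
  then have \<psi>: "\<psi> = (\<lambda>x. g x + Max ((\<lambda>i. f i x) ` {1..k}))" and k: "{1..k} \<noteq> {}" by auto
  show ?thesis
  proof (rule finite_composite_stationary_values[OF assms(1,2)])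
    show "quadratic_selection_on X \<psi>"
      unfolding \<psi> using f k g
      by (intro quadratic_selection_on_add piecewise_affine_selection quadratic_selection_on_Max) auto
    show "finite (\<psi> ` d_stationary \<psi> X)"
      unfolding \<psi> using f k g by (intro finite_stationary_values_affine_plus_max) auto
    show "finite ((\<lambda>x. - \<psi> x) ` d_stationary (\<lambda>x. - \<psi> x) X)"
      unfolding \<psi> using f k g assms(1)
      by (intro finite_stationary_values_minus_affine_plus_max) auto
  qed
next
  assume \<psi>: "max2_minus_max2_quadratic \<psi>"
  then obtain a1 a2 b1 b2 where
    quad: "quadratic_fun a1" "quadratic_fun a2" "quadratic_fun b1" "quadratic_fun b2"
    and "\<forall>x. \<psi> x = max (a1 x) (a2 x) - max (b1 x) (b2 x)"
    unfolding max2_minus_max2_quadratic_def by blast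
  then have eq: "\<psi> = (\<lambda>x. max (a1 x) (a2 x) + - max (b1 x) (b2 x))" by auto
  have "quadratic_selection_on X \<psi>"
    unfolding eq
    by (intro quadratic_selection_on_add quadratic_selection_on_uminus quadratic_selection_on_max2 quad)
  then show ?thesis
    by (intro finite_composite_stationary_values assms \<psi>
        finite_stationary_values_max2_minus_max2 max2_minus_max2_quadratic_uminus)
next
  assume "max_concave_minus_max_strictly_convex X \<psi>"
  then obtain k l f g where "1 \<le> (k::nat)" "1 \<le> (l::nat)"
    and f: "\<forall>i\<in>{1..k}. quadratic_fun (f i) \<and> concave_on UNIV (f i)"
    and g0: "\<forall>i\<in>{1..l}. quadratic_fun (g i) \<and> strictly_convex_on UNIV (g i)"
    and "\<forall>x. \<psi> x = Max ((\<lambda>i. f i x) ` {1..k}) - Max ((\<lambda>i. g i x) ` {1..l})"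
    unfolding max_concave_minus_max_strictly_convex_def by blast
  then have \<psi>: "\<psi> = (\<lambda>x. Max ((\<lambda>i. f i x) ` {1..k}) - Max ((\<lambda>i. g i x) ` {1..l}))"
    and kl: "{1..k} \<noteq> {}" "{1..l} \<noteq> {}" by auto
  have g: "\<forall>i\<in>{1..l}. quadratic_fun (g i) \<and> convex_on UNIV (g i)"
    using g0 strictly_convex_on_imp_convex_on by blast
  show ?thesis
  proof (rule finite_composite_stationary_values[OF assms(1,2)])
    have "quadratic_selection_on X (\<lambda>x. Max ((\<lambda>i. f i x) ` {1..k}) + - Max ((\<lambda>i. g i x) ` {1..l}))"
      using f g kl
      by (intro quadratic_selection_on_add quadratic_selection_on_uminus quadratic_selection_on_Max) auto
    then show "quadratic_selection_on X \<psi>" by (simp add: \<psi>)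
    show "finite (\<psi> ` d_stationary \<psi> X)"
      unfolding \<psi> using f g kl assms(1)
      by (intro finite_stationary_values_max_concave_minus_max_convex) auto
    have "(\<lambda>x. - \<psi> x) = (\<lambda>x. Max ((\<lambda>i. g i x) ` {1..l}) - Max ((\<lambda>i. f i x) ` {1..k}))"
      by (simp add: \<psi>)
    then show "finite ((\<lambda>x. - \<psi> x) ` d_stationary (\<lambda>x. - \<psi> x) X)"
      using f g kl by (simp only:) (intro finite_stationary_values_max_convex_minus_max_concave, auto)
  qed
qed

end
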